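(* Let $n\ge 3$, $q>1$, and let $u>0$ be a $C^4$-solution of \[ -\Delta^{2}u=u^{-q}\quad\text{in } B_R, \] where $B_R$ is the ball in $\mathbb{R}^n$ centered at $x_0$ with radius $R$. Assume that two constants $\alpha\ge 0$ and $\beta>0$ satisfy \[ \begin{cases} \alpha<\dfrac{-(n^{2}+4n-4)+\sqrt{(n^{2}+4n-4)^{2}+64n}}{16}\ \ (n\ge 4),\qquad \alpha<\dfrac{-7+2\sqrt{13}}{4}\ \ (n=3),\\[3mm] \beta\le\sqrt{\dfrac{2}{q-1-4\alpha/n}},\\[3mm] q\ge\max\Big\{\dfrac{8\alpha}{n}+3,\ 3\alpha+\sqrt{9\alpha^{2}+(1-2\alpha)(1+16\alpha/n)}\Big\}. \end{cases} \] Then \[ -\frac{\Delta u}{u}+\alpha\frac{|\nabla u|^{2}}{u^{2}}+\beta u^{-\frac{q+1}{2}}\le\frac{C}{R^{2}}\quad\text{in } B_R, \] where $C>0$ is a constant that does not depend on $R$.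
   Context: $B_R$ denotes the ball in $\mathbb{R}^n$ centered at the point $x_0$ with radius $R$. $\nabla$ and $\Delta$ are the Euclidean gradient and Laplacian, and $\Delta^2=\Delta\Delta$ is the bilaplacian.
   Formalization: The estimate is proved in B_{θR} for every 0<θ<1, with C depending on θ, n, q, α, β but not on R, x_0 or u, rather than in all of B_R with one C; the latter fails, since u may tend to 0 at the boundary while Δu stays below a negative constant. *)

theory Defs
  imports "HOL-Analysis.Analysis"
begin

definition partial_deriv :: "'a::euclidean_space \<Rightarrow> ('a \<Rightarrow> real) \<Rightarrow> 'a \<Rightarrow> real" where
  "partial_deriv b f x = frechet_derivative f (at x) b"

definition gradient :: "('a::euclidean_space \<Rightarrow> real) \<Rightarrow> 'a \<Rightarrow> 'a" where
  "gradient f x = (\<Sum>b\<in>Basis. partial_deriv b f x *\<^sub>R b)"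

definition laplacian :: "('a::euclidean_space \<Rightarrow> real) \<Rightarrow> 'a \<Rightarrow> real" where
  "laplacian f x = (\<Sum>b\<in>Basis. partial_deriv b (partial_deriv b f) x)"

definition bilaplacian :: "('a::euclidean_space \<Rightarrow> real) \<Rightarrow> 'a \<Rightarrow> real" where
  "bilaplacian f = laplacian (laplacian f)"

text \<open>The class \<open>C\<^sup>k(S)\<close>; meant for open \<open>S\<close>, since the derivatives are taken in the whole
  space at the points of \<open>S\<close>. The values of \<open>f\<close> outside \<open>S\<close> then play no role.\<close>

primrec Ck_on :: "nat \<Rightarrow> ('a::euclidean_space \<Rightarrow> real) \<Rightarrow> 'a set \<Rightarrow> bool" where
  "Ck_on 0 f S \<longleftrightarrow> continuous_on S f"
| "Ck_on (Suc k) f S \<longleftrightarrow>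
     (\<forall>x\<in>S. f differentiable (at x)) \<and> (\<forall>b\<in>Basis. Ck_on k (partial_deriv b f) S)"

lemma gderiv_gradient:
  assumes "f differentiable (at x)"
  shows "GDERIV f x :> gradient f x"
proof -
  have D: "(f has_derivative frechet_derivative f (at x)) (at x)"
    using assms by (simp add: frechet_derivative_works)
  then have lin: "linear (frechet_derivative f (at x))"
    by (rule has_derivative_linear)
  have "frechet_derivative f (at x) h = h \<bullet> gradient f x" for h
  proof -
    have "frechet_derivative f (at x) h = frechet_derivative f (at x) (\<Sum>b\<in>Basis. (h \<bullet> b) *\<^sub>R b)"
      by (simp add: euclidean_representation)
    also have "\<dots> = (\<Sum>b\<in>Basis. (h \<bullet> b) * frechet_derivative f (at x) b)"
      by (simp add: linear_sum[OF lin] linear_cmul[OF lin])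
    also have "\<dots> = h \<bullet> gradient f x"
      by (simp add: gradient_def partial_deriv_def inner_sum_right mult.commute)
    finally show ?thesis .
  qed
  then have "frechet_derivative f (at x) = (\<lambda>h. h \<bullet> gradient f x)"
    by blast
  with D show ?thesis
    by (simp add: gderiv_def)
qed

text \<open>An estimate by \<open>C / R\<^sup>2\<close> with \<open>C\<close> independent of \<open>R\<close> is an interior estimate: it cannot hold
  up to the boundary of \<open>B\<^sub>R\<close> with one constant, because a positive solution in \<open>B\<^sub>R\<close> may tend to
  \<open>0\<close> at the boundary while \<open>\<Delta>u\<close> stays below a negative constant. The theorem about
  these notions therefore covers all of \<open>B\<^sub>R\<close> by the concentric balls of radius \<open>\<theta> R\<close>,
  \<open>0 < \<theta> < 1\<close>; the constant may depend on \<open>\<theta>\<close>, \<open>n\<close>, \<open>q\<close>, \<open>\<alpha>\<close>, \<open>\<beta>\<close>, but not on \<open>R\<close>,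
  the centre or the solution.\<close>

end

theory Submission
  imports Defs
begin

text \<open>
  Put \<open>p = \<nabla>u/u\<close>, \<open>P = |p|\<^sup>2\<close>, \<open>a = -\<Delta>u/u\<close>, \<open>m = (q + 1)/2\<close>, \<open>s = \<beta> u\<^sup>-\<^sup>m\<close> and, for a parameter
  \<open>\<gamma> \<ge> \<alpha>\<close>, \<open>w = a + \<gamma> P + s\<close>. The claim is a Keller--Osserman bound for \<open>w\<close>: a function that
  satisfies \<open>\<Delta>w + 2(1 + \<gamma>) p\<cdot>\<nabla>w \<ge> c (w\<^sup>2 + P\<^sup>2)\<close> wherever it is nonnegative cannot exceed a
  multiple of \<open>1/R\<^sup>2\<close> well inside a ball of radius \<open>R\<close>, whatever its boundary values are.

  The differential inequality comes from three identities. The equation gives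
  \<open>\<Delta>a = u\<^sup>-\<^sup>q\<^sup>-\<^sup>1 - 2 p\<cdot>\<nabla>a + a\<^sup>2\<close> (\<open>laplacian_quotient\<close>). Since \<open>p\<close> is the gradient of \<open>log u\<close>, with
  divergence \<open>-a - P\<close>, Bochner's formula (\<open>bochner_curl_free\<close>) gives
  \<open>\<Delta>P = 2|D\<^sup>2 log u|\<^sup>2 - 2 p\<cdot>\<nabla>a - 2 p\<cdot>\<nabla>P\<close>. The third is the Laplacian of a power of \<open>u\<close>.
  The drift \<open>2(1 + \<gamma>) p\<close> is chosen so that the terms with \<open>\<nabla>a\<close> cancel; the second derivatives of \<open>log u\<close>
  then enter, besides \<open>a\<close>, only through \<open>2\<gamma> (|D\<^sup>2 log u|\<^sup>2 + \<gamma> p\<cdot>\<nabla>P)\<close>, which is bounded below by completing the square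
  and comparing a matrix with its trace (\<open>sum_squares_hessian_lower\<close>). This leaves a quadratic form
  in \<open>(w, P, s)\<close>, called \<open>source\<close> below (\<open>auxiliary_function_inequality\<close>).

  The hypotheses are what makes that form coercive on nonnegative arguments: the bound on \<open>\<beta>\<close> and
  the two lower bounds on \<open>q\<close> say that the coefficients of \<open>s\<^sup>2\<close>, \<open>w s\<close> and \<open>s P\<close> are
  nonnegative, and the bound on \<open>\<alpha>\<close> makes the remaining form in \<open>(w, P)\<close> positive definite. All terms
  with \<open>P\<^sup>2\<close> carry a factor \<open>\<gamma>\<close>, so \<open>\<gamma> = \<alpha>\<close> works only for \<open>\<alpha> > 0\<close>; for \<open>\<alpha> = 0\<close> a small
  positive \<open>\<gamma>\<close> is used, and the estimate for it is stronger (\<open>source_coercive\<close>).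

  For the bound itself let \<open>\<zeta> = \<rho>\<^sup>2 - |x - x\<^sub>0|\<^sup>2\<close> and suppose that the
  maximum \<open>M\<close> of \<open>w \<zeta>\<^sup>2\<close> is positive. Then \<open>M \<zeta>\<^sup>-\<^sup>2\<close>
  touches \<open>w\<close> from above, and comparing first and second derivatives at the contact point yields
  \<open>M \<le> L \<rho>\<^sup>2\<close> (\<open>interior_estimate\<close>). The power \<open>-2\<close> matches the scaling of the inequality, and the
  term \<open>P\<^sup>2\<close> absorbs the drift.
\<close>

section \<open>Calculus of \<open>C\<^sup>k\<close> functions and partial derivatives\<close>

lemma partial_deriv_eqI:
  assumes "(f has_derivative f') (at x)"
  shows "partial_deriv b f x = f' b"
  using frechet_derivative_at[OF assms] by (simp add: partial_deriv_def)

lemma differentiable_has_frechet_derivative: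
  "f differentiable (at x) \<Longrightarrow> (f has_derivative frechet_derivative f (at x)) (at x)"
  by (simp add: frechet_derivative_works)

text \<open>The two functions have the same derivatives at \<open>x\<close>, if any, and \<open>frechet_derivative\<close> is a
  choice among these. This is what lets identities that hold on an open
  set be differentiated again.\<close>

lemma partial_deriv_cong:
  assumes "open S" "x \<in> S" "\<And>y. y \<in> S \<Longrightarrow> f y = g y"
  shows "partial_deriv b f x = partial_deriv b g x"
proof -
  have "(f has_derivative D) (at x) \<longleftrightarrow> (g has_derivative D) (at x)" for D
    using assms by (metis has_derivative_transform_within_open)
  then show ?thesis
    by (simp add: partial_deriv_def frechet_derivative_def)
qed

lemma Ck_on_cong:
  assumes "open S" "\<And>x. x \<in> S \<Longrightarrow> f x = g x" "Ck_on k f S"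
  shows "Ck_on k g S"
  using assms(2,3)
proof (induction k arbitrary: f g)
  case 0
  then show ?case
    by (simp cong: continuous_on_cong)
next
  case (Suc k)
  have "g differentiable (at x)" if "x \<in> S" for x
  proof -
    have "(f has_derivative frechet_derivative f (at x)) (at x)"
      using Suc.prems(2) that by (simp add: frechet_derivative_works)
    then have "(g has_derivative frechet_derivative f (at x)) (at x)"
      by (rule has_derivative_transform_within_open[OF _ assms(1) that]) (rule Suc.prems(1))
    then show ?thesis
      by (rule differentiableI)
  qed
  moreover have "Ck_on k (partial_deriv b g) S" if "b \<in> Basis" for b
  proof (rule Suc.IH[of "partial_deriv b f"])
    show "Ck_on k (partial_deriv b f) S"
      using Suc.prems(2) that by simp
    show "partial_deriv b f x = partial_deriv b g x" if "x \<in> S" for x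
      by (rule partial_deriv_cong[OF assms(1) that Suc.prems(1)])
  qed
  ultimately show ?case
    by simp
qed

lemma Ck_on_imp_continuous_on: "Ck_on k f S \<Longrightarrow> continuous_on S f"
  by (cases k) (auto intro: continuous_at_imp_continuous_on differentiable_imp_continuous_within)

lemma Ck_on_SucD: "Ck_on (Suc k) f S \<Longrightarrow> Ck_on k f S"
proof (induction k arbitrary: f)
  case 0
  then show ?case
    using Ck_on_imp_continuous_on by fastforce
qed simp

lemma Ck_on_le: "Ck_on l f S \<Longrightarrow> k \<le> l \<Longrightarrow> Ck_on k f S"
proof (induction l)
  case (Suc l)
  then show ?case
    by (metis Ck_on_SucD le_Suc_eq)
qed simp

lemma Ck_on_subset: "Ck_on k f S \<Longrightarrow> T \<subseteq> S \<Longrightarrow> Ck_on k f T"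
  by (induction k arbitrary: f) (auto intro: continuous_on_subset)

lemma Ck_on_differentiable: "Ck_on k f S \<Longrightarrow> k \<noteq> 0 \<Longrightarrow> x \<in> S \<Longrightarrow> f differentiable (at x)"
  by (cases k) auto

lemma Ck_on_partial_deriv: "Ck_on (Suc k) f S \<Longrightarrow> b \<in> Basis \<Longrightarrow> Ck_on k (partial_deriv b f) S"
  by simp

lemma partial_deriv_const: "partial_deriv b (\<lambda>x. c) = (\<lambda>x. 0)"
  by (simp add: partial_deriv_def fun_eq_iff)

lemma partial_deriv_add:
  assumes "f differentiable (at x)" "g differentiable (at x)"
  shows "partial_deriv b (\<lambda>x. f x + g x) x = partial_deriv b f x + partial_deriv b g x"
  by (subst partial_deriv_eqI[OF has_derivative_add[OF
        assms[THEN differentiable_has_frechet_derivative]]])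
    (simp add: partial_deriv_def)

lemma partial_deriv_sum:
  assumes "\<And>i. i \<in> I \<Longrightarrow> f i differentiable (at x)"
  shows "partial_deriv b (\<lambda>x. \<Sum>i\<in>I. f i x) x = (\<Sum>i\<in>I. partial_deriv b (f i) x)"
  by (subst partial_deriv_eqI[OF has_derivative_sum[OF
        assms[THEN differentiable_has_frechet_derivative]]])
    (simp_all add: partial_deriv_def)

lemma partial_deriv_mult:
  assumes "f differentiable (at x)" "g differentiable (at x)"
  shows "partial_deriv b (\<lambda>x. f x * g x) x = partial_deriv b f x * g x + f x * partial_deriv b g x"
  by (subst partial_deriv_eqI[OF has_derivative_mult[OF
        assms[THEN differentiable_has_frechet_derivative]]])
    (simp add: partial_deriv_def)

lemma powr_has_frechet_derivative:
  fixes f :: "'a::euclidean_space \<Rightarrow> real"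
  assumes "f differentiable (at x)" "f x > 0"
  shows "((\<lambda>x. f x powr r) has_derivative
    (\<lambda>h. r * f x powr (r - 1) * frechet_derivative f (at x) h)) (at x)"
proof -
  have "((\<lambda>t. t powr r) has_derivative (*) (r * f x powr (r - 1))) (at (f x))"
    using has_real_derivative_powr[OF assms(2), of r] by (simp add: has_field_derivative_def)
  from has_derivative_compose[OF differentiable_has_frechet_derivative[OF assms(1)] this]
  show ?thesis .
qed

lemma partial_deriv_powr:
  assumes "f differentiable (at x)" "f x > 0"
  shows "partial_deriv b (\<lambda>x. f x powr r) x = r * f x powr (r - 1) * partial_deriv b f x"
  by (subst partial_deriv_eqI[OF powr_has_frechet_derivative[OF assms]])
    (simp add: partial_deriv_def)

lemma Ck_on_const: "Ck_on k (\<lambda>x. c) S"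
  by (induction k arbitrary: c) (simp_all add: partial_deriv_const)

lemma Ck_on_add:
  assumes "open S"
  shows "Ck_on k f S \<Longrightarrow> Ck_on k g S \<Longrightarrow> Ck_on k (\<lambda>x. f x + g x) S"
proof (induction k arbitrary: f g)
  case 0
  then show ?case
    by (simp add: continuous_on_add)
next
  case (Suc k)
  have "Ck_on k (partial_deriv b (\<lambda>x. f x + g x)) S" if "b \<in> Basis" for b
    by (rule Ck_on_cong[OF assms _ Suc.IH[of "partial_deriv b f" "partial_deriv b g"]])
      (use Suc.prems that in \<open>auto simp: partial_deriv_add\<close>)
  then show ?case
    using Suc.prems by (auto intro: differentiable_add)
qed

lemma Ck_on_mult:
  assumes "open S"
  shows "Ck_on k f S \<Longrightarrow> Ck_on k g S \<Longrightarrow> Ck_on k (\<lambda>x. f x * g x) S"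
proof (induction k arbitrary: f g)
  case 0
  then show ?case
    by (simp add: continuous_on_mult)
next
  case (Suc k)
  have "Ck_on k (partial_deriv b (\<lambda>x. f x * g x)) S" if "b \<in> Basis" for b
    by (rule Ck_on_cong[OF assms _ Ck_on_add[OF assms
            Suc.IH[of "partial_deriv b f" g] Suc.IH[of f "partial_deriv b g"]]])
      (use Suc.prems that Ck_on_SucD in \<open>auto simp: partial_deriv_mult\<close>)
  then show ?case
    using Suc.prems by (auto intro: differentiable_mult)
qed

lemma Ck_on_sum:
  assumes "open S" "\<And>i. i \<in> I \<Longrightarrow> Ck_on k (f i) S"
  shows "Ck_on k (\<lambda>x. \<Sum>i\<in>I. f i x) S"
  using assms(2) by (induction I rule: infinite_finite_induct)
    (simp_all add: Ck_on_const Ck_on_add[OF assms(1)])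

lemma Ck_on_powr:
  assumes "open S" "\<And>x. x \<in> S \<Longrightarrow> f x > 0"
  shows "Ck_on k f S \<Longrightarrow> Ck_on k (\<lambda>x. f x powr r) S"
proof (induction k arbitrary: r)
  case 0
  then show ?case
    using assms(2) by (force intro!: continuous_intros)
next
  case (Suc k)
  have "Ck_on k (partial_deriv b (\<lambda>x. f x powr r)) S" if "b \<in> Basis" for b
  proof (rule Ck_on_cong[OF assms(1)])
    show "Ck_on k (\<lambda>x. (r * f x powr (r - 1)) * partial_deriv b f x) S"
      using Suc.prems that
      by (intro Ck_on_mult[OF assms(1)] Ck_on_const Suc.IH Ck_on_SucD[OF Suc.prems]) simp
  qed (use Suc.prems assms in \<open>auto simp: partial_deriv_powr\<close>)
  moreover have "(\<lambda>x. f x powr r) differentiable (at x)" if "x \<in> S" for x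
    using powr_has_frechet_derivative[of f x] assms that Suc.prems by (auto intro: differentiableI)
  ultimately show ?case
    by simp
qed

lemma Ck_on_cmult: "open S \<Longrightarrow> Ck_on k f S \<Longrightarrow> Ck_on k (\<lambda>x. c * f x) S"
  by (intro Ck_on_mult Ck_on_const)

lemma partial_deriv_cmult:
  "f differentiable (at x) \<Longrightarrow> partial_deriv b (\<lambda>x. c * f x) x = c * partial_deriv b f x"
  by (subst partial_deriv_mult) (simp_all add: partial_deriv_const)

lemma Ck_on_divide:
  assumes "open S" "Ck_on k f S" "Ck_on k g S" "\<And>x. x \<in> S \<Longrightarrow> g x > 0"
  shows "Ck_on k (\<lambda>x. f x / g x) S"
proof (rule Ck_on_cong[OF assms(1)])
  show "Ck_on k (\<lambda>x. f x * g x powr (-1)) S"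
    by (intro Ck_on_mult Ck_on_powr assms)
qed (use assms(4) in \<open>auto simp: powr_minus_divide abs_of_pos\<close>)

lemma DERIV_along_line:
  fixes f :: "'a::euclidean_space \<Rightarrow> real"
  assumes "f differentiable (at (x + t *\<^sub>R b))"
  shows "((\<lambda>t. f (x + t *\<^sub>R b)) has_real_derivative partial_deriv b f (x + t *\<^sub>R b)) (at t)"
proof -
  let ?D = "frechet_derivative f (at (x + t *\<^sub>R b))"
  have D: "(f has_derivative ?D) (at (x + t *\<^sub>R b))"
    using assms by (rule differentiable_has_frechet_derivative)
  have "((\<lambda>t. x + t *\<^sub>R b) has_derivative (\<lambda>h. h *\<^sub>R b)) (at t)"
    by (auto intro!: derivative_eq_intros)
  from has_derivative_compose[OF this D]
  have "((\<lambda>t. f (x + t *\<^sub>R b)) has_derivative (\<lambda>h. ?D (h *\<^sub>R b))) (at t)" .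
  moreover have "(\<lambda>h. ?D (h *\<^sub>R b)) = (*) (?D b)"
    using linear_cmul[OF has_derivative_linear[OF D]] by (auto simp: fun_eq_iff)
  ultimately show ?thesis
    by (simp add: has_field_derivative_def partial_deriv_def)
qed

text \<open>Applying the mean value theorem first to the increment in direction \<open>c\<close>, as a function of the step
  in direction \<open>b\<close>, and then in direction \<open>c\<close>, expresses the second difference by a mixed derivative.
  The second difference is symmetric in \<open>b\<close> and \<open>c\<close>.\<close>

lemma second_difference_mvt:
  fixes f :: "'a::euclidean_space \<Rightarrow> real"
  assumes f: "Ck_on 2 f S" and bc: "b \<in> Basis" "c \<in> Basis" and t: "t > 0"
    and S: "\<And>r s. 0 \<le> r \<Longrightarrow> r \<le> t \<Longrightarrow> 0 \<le> s \<Longrightarrow> s \<le> t \<Longrightarrow> x + r *\<^sub>R b + s *\<^sub>R c \<in> S"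
  shows "\<exists>r s. 0 < r \<and> r < t \<and> 0 < s \<and> s < t \<and>
    f (x + t *\<^sub>R b + t *\<^sub>R c) - f (x + t *\<^sub>R b) - f (x + t *\<^sub>R c) + f x
      = t\<^sup>2 * partial_deriv c (partial_deriv b f) (x + r *\<^sub>R b + s *\<^sub>R c)"
proof -
  have df: "f differentiable (at y)" and dp: "partial_deriv b f differentiable (at y)" if "y \<in> S" for y
    using f bc that by (simp_all add: numeral_2_eq_2)
  define g where "g r = f ((x + t *\<^sub>R c) + r *\<^sub>R b) - f (x + r *\<^sub>R b)" for r
  have "(g has_real_derivative
      (partial_deriv b f ((x + t *\<^sub>R c) + r *\<^sub>R b) - partial_deriv b f (x + r *\<^sub>R b))) (at r)"
    if "0 \<le> r" "r \<le> t" for r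
    unfolding g_def
    using S[of r t] S[of r 0] that t
    by (intro DERIV_diff DERIV_along_line df) (simp_all add: ac_simps)
  from MVT2[OF t this] obtain r where r: "0 < r" "r < t"
    and gr: "g t - g 0 = t * (partial_deriv b f ((x + t *\<^sub>R c) + r *\<^sub>R b) - partial_deriv b f (x + r *\<^sub>R b))"
    by auto
  have "((\<lambda>s. partial_deriv b f ((x + r *\<^sub>R b) + s *\<^sub>R c)) has_real_derivative
      partial_deriv c (partial_deriv b f) ((x + r *\<^sub>R b) + s *\<^sub>R c)) (at s)"
    if "0 \<le> s" "s \<le> t" for s
    using S[of r s] that r by (intro DERIV_along_line dp) simp_all
  from MVT2[OF t this] obtain s where s: "0 < s" "s < t"
    and "partial_deriv b f (x + r *\<^sub>R b + t *\<^sub>R c) - partial_deriv b f (x + r *\<^sub>R b)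
      = t * partial_deriv c (partial_deriv b f) (x + r *\<^sub>R b + s *\<^sub>R c)"
    by auto
  with gr have "g t - g 0 = t\<^sup>2 * partial_deriv c (partial_deriv b f) (x + r *\<^sub>R b + s *\<^sub>R c)"
    by (simp add: power2_eq_square ac_simps)
  moreover have "g t - g 0 =
      f (x + t *\<^sub>R b + t *\<^sub>R c) - f (x + t *\<^sub>R b) - f (x + t *\<^sub>R c) + f x"
    by (simp add: g_def ac_simps)
  ultimately show ?thesis
    using r s by metis
qed

text \<open>Schwarz's theorem. The same second difference over a square of side \<open>t\<close> is \<open>t\<^sup>2\<close> times either mixed
  derivative at points within \<open>3t\<close> of \<open>x\<close>; if the mixed derivatives differed at \<open>x\<close>, continuity would separate
  these values for small \<open>t\<close>.\<close>

lemma partial_deriv_commute: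
  fixes f :: "'a::euclidean_space \<Rightarrow> real"
  assumes S: "open S" "x \<in> S" and f: "Ck_on 2 f S" and bc: "b \<in> Basis" "c \<in> Basis"
  shows "partial_deriv b (partial_deriv c f) x = partial_deriv c (partial_deriv b f) x"
proof (rule ccontr)
  let ?A = "partial_deriv b (partial_deriv c f)" and ?B = "partial_deriv c (partial_deriv b f)"
  assume ne: "?A x \<noteq> ?B x"
  define e where "e = \<bar>?A x - ?B x\<bar> / 2"
  have e: "e > 0"
    using ne by (simp add: e_def)
  have "continuous_on S ?A" "continuous_on S ?B"
    using f bc by (simp_all add: numeral_2_eq_2)
  then have "isCont ?A x" "isCont ?B x"
    using S by (simp_all add: continuous_on_eq_continuous_at)
  then obtain d1 d2 where d: "d1 > 0" "d2 > 0"
    "\<And>y. dist y x < d1 \<Longrightarrow> \<bar>?A y - ?A x\<bar> < e" "\<And>y. dist y x < d2 \<Longrightarrow> \<bar>?B y - ?B x\<bar> < e"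
    unfolding continuous_at_eps_delta dist_real_def using e by metis
  obtain d0 where d0: "d0 > 0" "ball x d0 \<subseteq> S"
    using S openE by blast
  define t where "t = min d0 (min d1 d2) / 3"
  have t: "t > 0" "t * 3 \<le> d0" "t * 3 \<le> d1" "t * 3 \<le> d2"
    using d(1,2) d0 by (auto simp: t_def)
  have near: "dist (x + r *\<^sub>R i + s *\<^sub>R j) x < t * 3"
    if "0 \<le> r" "r \<le> t" "0 \<le> s" "s \<le> t" "i \<in> Basis" "j \<in> Basis" for r s and i j :: 'a
  proof -
    have "dist (x + r *\<^sub>R i + s *\<^sub>R j) x = norm (r *\<^sub>R i + s *\<^sub>R j)"
      by (simp add: dist_norm add.assoc)
    also have "\<dots> \<le> norm (r *\<^sub>R i) + norm (s *\<^sub>R j)"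
      by (rule norm_triangle_ineq)
    also have "\<dots> < t * 3"
      using that t by simp
    finally show ?thesis .
  qed
  then have inS: "x + r *\<^sub>R i + s *\<^sub>R j \<in> S"
    if "0 \<le> r" "r \<le> t" "0 \<le> s" "s \<le> t" "i \<in> Basis" "j \<in> Basis" for r s i j
    using that d0 t by (force simp: dist_commute)
  obtain r s where rs: "0 < r" "r < t" "0 < s" "s < t"
    "f (x + t *\<^sub>R b + t *\<^sub>R c) - f (x + t *\<^sub>R b) - f (x + t *\<^sub>R c) + f x
      = t\<^sup>2 * ?B (x + r *\<^sub>R b + s *\<^sub>R c)"
    using second_difference_mvt[OF f bc t(1) inS] bc by blast
  obtain r' s' where rs': "0 < r'" "r' < t" "0 < s'" "s' < t"
    "f (x + t *\<^sub>R c + t *\<^sub>R b) - f (x + t *\<^sub>R c) - f (x + t *\<^sub>R b) + f x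
      = t\<^sup>2 * ?A (x + r' *\<^sub>R c + s' *\<^sub>R b)"
    using second_difference_mvt[OF f bc(2,1) t(1) inS] bc by blast
  have "t\<^sup>2 * ?A (x + r' *\<^sub>R c + s' *\<^sub>R b) = t\<^sup>2 * ?B (x + r *\<^sub>R b + s *\<^sub>R c)"
    using rs(5) rs'(5) by (simp only: add.assoc add.commute[of "t *\<^sub>R c"])
  then have "?A (x + r' *\<^sub>R c + s' *\<^sub>R b) = ?B (x + r *\<^sub>R b + s *\<^sub>R c)"
    using t(1) by simp
  moreover have "\<bar>?A (x + r' *\<^sub>R c + s' *\<^sub>R b) - ?A x\<bar> < e"
    using near[of r' s' c b] rs' t bc by (intro d(3)) simp
  moreover have "\<bar>?B (x + r *\<^sub>R b + s *\<^sub>R c) - ?B x\<bar> < e"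
    using near[of r s b c] rs t bc by (intro d(4)) simp
  ultimately show False
    unfolding e_def by argo
qed

text \<open>Restrict \<open>F\<close> to the line through \<open>y\<close> in direction \<open>b\<close>. A positive second derivative there would make
  the first derivative, which vanishes at \<open>y\<close>, positive just beyond \<open>y\<close>, so that \<open>F\<close> would increase.\<close>

lemma partial_derivs_at_max:
  fixes F :: "'a::euclidean_space \<Rightarrow> real"
  assumes S: "open S" "y \<in> S" and F: "Ck_on 2 F S" and b: "b \<in> Basis"
    and max: "\<And>x. x \<in> S \<Longrightarrow> F x \<le> F y"
  shows "partial_deriv b F y = 0" and "partial_deriv b (partial_deriv b F) y \<le> 0"
proof -
  obtain e where e: "e > 0" "ball y e \<subseteq> S"
    using S openE by blast
  have inS: "y + t *\<^sub>R b \<in> S" if "\<bar>t\<bar> < e" for t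
  proof -
    have "y + t *\<^sub>R b \<in> ball y e"
      using that b by (simp add: dist_norm)
    then show ?thesis
      using e by blast
  qed
  have d1: "((\<lambda>t. F (y + t *\<^sub>R b)) has_real_derivative partial_deriv b F (y + t *\<^sub>R b)) (at t)"
    if "\<bar>t\<bar> < e" for t
    using F inS[OF that] by (intro DERIV_along_line) (simp add: numeral_2_eq_2)
  have "((\<lambda>t. partial_deriv b F (y + t *\<^sub>R b)) has_real_derivative
      partial_deriv b (partial_deriv b F) (y + 0 *\<^sub>R b)) (at 0)"
    using F b S by (intro DERIV_along_line) (simp add: numeral_2_eq_2)
  then have d2: "((\<lambda>t. partial_deriv b F (y + t *\<^sub>R b)) has_real_derivative
      partial_deriv b (partial_deriv b F) y) (at 0)"
    by simp
  have "\<forall>t. \<bar>0 - t\<bar> < e \<longrightarrow> F (y + t *\<^sub>R b) \<le> F (y + 0 *\<^sub>R b)"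
    using max inS by simp
  from DERIV_local_max[OF d1 e(1) this] e show z: "partial_deriv b F y = 0"
    by simp
  show "partial_deriv b (partial_deriv b F) y \<le> 0"
  proof (rule ccontr)
    assume "\<not> ?thesis"
    then obtain d where d: "d > 0"
      "\<And>h. 0 < h \<Longrightarrow> h < d \<Longrightarrow> 0 < partial_deriv b F (y + h *\<^sub>R b)"
      using DERIV_pos_inc_right[OF d2] z by auto
    define h where "h = min d e / 2"
    have h: "0 < h" "h < d" "h < e"
      using d e by (auto simp: h_def)
    have d1': "((\<lambda>t. F (y + t *\<^sub>R b)) has_real_derivative partial_deriv b F (y + t *\<^sub>R b)) (at t)"
      if "0 \<le> t" "t \<le> h" for t
      using that h by (intro d1) simp
    from MVT2[OF h(1) d1'] obtain r where "0 < r" "r < h"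
      "F (y + h *\<^sub>R b) - F (y + 0 *\<^sub>R b) = (h - 0) * partial_deriv b F (y + r *\<^sub>R b)"
      by blast
    moreover from this have "h * partial_deriv b F (y + r *\<^sub>R b) > 0"
      using d(2)[of r] h by (intro mult_pos_pos) auto
    ultimately have "F (y + h *\<^sub>R b) > F y"
      by simp
    with max[OF inS[of h]] h show False
      by simp
  qed
qed

section \<open>The Laplacian and Bochner's formula\<close>

lemma inner_gradient: "b \<in> Basis \<Longrightarrow> gradient f x \<bullet> b = partial_deriv b f x"
  by (simp add: gradient_def)

lemma laplacian_cong:
  assumes "open S" "x \<in> S" "\<And>y. y \<in> S \<Longrightarrow> f y = g y"
  shows "laplacian f x = laplacian g x"
  unfolding laplacian_def
proof (rule sum.cong)
  fix b :: 'a
  show "partial_deriv b (partial_deriv b f) x = partial_deriv b (partial_deriv b g) x"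
    by (rule partial_deriv_cong[OF assms(1,2)]) (rule partial_deriv_cong[OF assms(1) _ assms(3)])
qed simp

lemma laplacian_add:
  assumes "open S" "x \<in> S" "Ck_on 2 f S" "Ck_on 2 g S"
  shows "laplacian (\<lambda>x. f x + g x) x = laplacian f x + laplacian g x"
proof -
  have "partial_deriv b (partial_deriv b (\<lambda>x. f x + g x)) x
      = partial_deriv b (partial_deriv b f) x + partial_deriv b (partial_deriv b g) x"
    if "b \<in> Basis" for b
  proof -
    have "partial_deriv b (partial_deriv b (\<lambda>x. f x + g x)) x
        = partial_deriv b (\<lambda>x. partial_deriv b f x + partial_deriv b g x) x"
      using assms by (intro partial_deriv_cong[of S x] partial_deriv_add) (auto simp: numeral_2_eq_2)
    also have "\<dots> = partial_deriv b (partial_deriv b f) x + partial_deriv b (partial_deriv b g) x"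
      using assms that by (intro partial_deriv_add) (auto simp: numeral_2_eq_2)
    finally show ?thesis .
  qed
  then show ?thesis
    by (simp add: laplacian_def sum.distrib)
qed

lemma laplacian_mult:
  assumes "open S" "x \<in> S" "Ck_on 2 f S" "Ck_on 2 g S"
  shows "laplacian (\<lambda>x. f x * g x) x = laplacian f x * g x
    + 2 * (\<Sum>b\<in>Basis. partial_deriv b f x * partial_deriv b g x) + f x * laplacian g x"
proof -
  have "partial_deriv b (partial_deriv b (\<lambda>x. f x * g x)) x
      = partial_deriv b (partial_deriv b f) x * g x
        + 2 * (partial_deriv b f x * partial_deriv b g x) + f x * partial_deriv b (partial_deriv b g) x"
    if b: "b \<in> Basis" for b
  proof -
    have d: "f differentiable (at x)" "g differentiable (at x)"
      "partial_deriv b f differentiable (at x)" "partial_deriv b g differentiable (at x)"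
      using assms b by (auto simp: numeral_2_eq_2)
    have "partial_deriv b (partial_deriv b (\<lambda>x. f x * g x)) x
        = partial_deriv b (\<lambda>x. partial_deriv b f x * g x + f x * partial_deriv b g x) x"
      using assms by (intro partial_deriv_cong[of S x] partial_deriv_mult) (auto simp: numeral_2_eq_2)
    also have "\<dots> = partial_deriv b (\<lambda>x. partial_deriv b f x * g x) x
        + partial_deriv b (\<lambda>x. f x * partial_deriv b g x) x"
      using d by (intro partial_deriv_add) (auto intro: differentiable_mult)
    finally show ?thesis
      using d by (simp add: partial_deriv_mult)
  qed
  then show ?thesis
    by (simp add: laplacian_def sum.distrib sum_distrib_left sum_distrib_right)
qed

lemma laplacian_const: "laplacian (\<lambda>x. c) x = 0"
  by (simp add: laplacian_def partial_deriv_const)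

lemma laplacian_cmult:
  assumes "open S" "x \<in> S" "Ck_on 2 f S"
  shows "laplacian (\<lambda>x. c * f x) x = c * laplacian f x"
  by (subst laplacian_mult[OF assms(1,2) Ck_on_const assms(3)])
    (simp add: partial_deriv_const laplacian_const)

lemma laplacian_sum:
  assumes "open S" "x \<in> S" "\<And>i. i \<in> I \<Longrightarrow> Ck_on 2 (f i) S"
  shows "laplacian (\<lambda>x. \<Sum>i\<in>I. f i x) x = (\<Sum>i\<in>I. laplacian (f i) x)"
  using assms(3) by (induction I rule: infinite_finite_induct)
    (simp_all add: laplacian_const laplacian_add[OF assms(1,2)] Ck_on_sum[OF assms(1)])

lemma laplacian_powr:
  assumes S: "open S" "x \<in> S" and f: "Ck_on 2 f S" and pos: "\<And>y. y \<in> S \<Longrightarrow> f y > 0"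
  shows "laplacian (\<lambda>x. f x powr r) x = r * f x powr (r - 1) * laplacian f x
    + r * (r - 1) * f x powr (r - 2) * (\<Sum>b\<in>Basis. (partial_deriv b f x)\<^sup>2)"
proof -
  have "partial_deriv b (partial_deriv b (\<lambda>x. f x powr r)) x
      = r * f x powr (r - 1) * partial_deriv b (partial_deriv b f) x
        + r * (r - 1) * f x powr (r - 2) * (partial_deriv b f x)\<^sup>2"
    if b: "b \<in> Basis" for b
  proof -
    have d: "f differentiable (at x)" "partial_deriv b f differentiable (at x)"
      using S f b by (auto simp: numeral_2_eq_2)
    have dp: "(\<lambda>x. f x powr (r - 1)) differentiable (at x)"
      using powr_has_frechet_derivative[OF d(1)] pos S by (auto intro: differentiableI)
    have "partial_deriv b (partial_deriv b (\<lambda>x. f x powr r)) x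
        = partial_deriv b (\<lambda>x. r * (f x powr (r - 1) * partial_deriv b f x)) x"
      using S f pos
      by (intro partial_deriv_cong[of S x]) (auto simp: numeral_2_eq_2 partial_deriv_powr)
    also have "\<dots> = r * (partial_deriv b (\<lambda>x. f x powr (r - 1)) x * partial_deriv b f x
        + f x powr (r - 1) * partial_deriv b (partial_deriv b f) x)"
      using d dp by (subst partial_deriv_cmult) (auto intro: differentiable_mult simp: partial_deriv_mult)
    also have "partial_deriv b (\<lambda>x. f x powr (r - 1)) x
        = (r - 1) * f x powr (r - 2) * partial_deriv b f x"
      using d pos S by (simp add: partial_deriv_powr)
    finally show ?thesis
      by (simp add: algebra_simps power2_eq_square)
  qed
  then show ?thesis
    by (simp add: laplacian_def sum.distrib sum_distrib_left)
qed

text \<open>Complete the square, \<open>|H|\<^sup>2 + 2\<gamma> H(p,p) = |H + \<gamma> p\<otimes>p|\<^sup>2 - \<gamma>\<^sup>2|p|\<^sup>4\<close>, drop the off-diagonal entries of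
  \<open>H + \<gamma> p\<otimes>p\<close>, and bound the sum of squares of the diagonal by the square of the trace.\<close>

lemma sum_squares_hessian_lower:
  fixes H :: "'b \<Rightarrow> 'b \<Rightarrow> real" and p :: "'b \<Rightarrow> real" and \<gamma> :: real
  assumes "finite I" "I \<noteq> {}"
  shows "((\<Sum>i\<in>I. H i i) + \<gamma> * (\<Sum>i\<in>I. (p i)\<^sup>2))\<^sup>2 / card I - \<gamma>\<^sup>2 * (\<Sum>i\<in>I. (p i)\<^sup>2)\<^sup>2
    \<le> (\<Sum>i\<in>I. \<Sum>j\<in>I. (H i j)\<^sup>2) + 2 * \<gamma> * (\<Sum>i\<in>I. \<Sum>j\<in>I. p i * p j * H i j)"
proof -
  have card: "real (card I) > 0"
    using assms by (simp add: card_gt_0_iff)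
  have "((\<Sum>i\<in>I. H i i) + \<gamma> * (\<Sum>i\<in>I. (p i)\<^sup>2))\<^sup>2 = (\<Sum>i\<in>I. H i i + \<gamma> * (p i)\<^sup>2)\<^sup>2"
    by (simp add: sum.distrib sum_distrib_left)
  also have "\<dots> \<le> (\<Sum>i\<in>I. (H i i + \<gamma> * (p i)\<^sup>2)\<^sup>2) * real (card I)"
    by (rule sum_squared_le_sum_of_squares)
  finally have "((\<Sum>i\<in>I. H i i) + \<gamma> * (\<Sum>i\<in>I. (p i)\<^sup>2))\<^sup>2 / card I
      \<le> (\<Sum>i\<in>I. (H i i + \<gamma> * (p i)\<^sup>2)\<^sup>2)"
    using card by (simp add: field_simps)
  also have "\<dots> \<le> (\<Sum>i\<in>I. \<Sum>j\<in>I. (H i j + \<gamma> * (p i * p j))\<^sup>2)"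
  proof (rule sum_mono)
    fix i assume "i \<in> I"
    then show "(H i i + \<gamma> * (p i)\<^sup>2)\<^sup>2 \<le> (\<Sum>j\<in>I. (H i j + \<gamma> * (p i * p j))\<^sup>2)"
      using member_le_sum[of i I "\<lambda>j. (H i j + \<gamma> * (p i * p j))\<^sup>2"] assms(1)
      by (simp add: power2_eq_square[of "p i"])
  qed
  also have "\<dots> = (\<Sum>i\<in>I. \<Sum>j\<in>I. (H i j)\<^sup>2 + 2 * \<gamma> * (p i * p j * H i j) + \<gamma>\<^sup>2 * ((p i)\<^sup>2 * (p j)\<^sup>2))"
    by (intro sum.cong refl) (simp add: algebra_simps power2_eq_square)
  also have "\<dots> = (\<Sum>i\<in>I. \<Sum>j\<in>I. (H i j)\<^sup>2) + 2 * \<gamma> * (\<Sum>i\<in>I. \<Sum>j\<in>I. p i * p j * H i j)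
      + \<gamma>\<^sup>2 * (\<Sum>i\<in>I. \<Sum>j\<in>I. (p i)\<^sup>2 * (p j)\<^sup>2)"
    by (simp add: sum.distrib sum_distrib_left)
  also have "(\<Sum>i\<in>I. \<Sum>j\<in>I. (p i)\<^sup>2 * (p j)\<^sup>2) = (\<Sum>i\<in>I. (p i)\<^sup>2)\<^sup>2"
    by (simp only: power2_eq_square[of "\<Sum>i\<in>I. (p i)\<^sup>2"] sum_product)
  finally show ?thesis
    by simp
qed

text \<open>Bochner's formula for \<open>p = \<nabla>f\<close>, with the existence of \<open>f\<close> replaced by the symmetry of the
  derivative of \<open>p\<close>. That symmetry and Schwarz's theorem turn the Laplacian of a component of \<open>p\<close> into a
  derivative of the divergence of \<open>p\<close>.\<close>

lemma bochner_curl_free: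
  fixes p :: "'a::euclidean_space \<Rightarrow> 'a \<Rightarrow> real"
  assumes S: "open S" "x \<in> S"
    and p: "\<And>i. i \<in> Basis \<Longrightarrow> Ck_on 2 (p i) S"
    and curl: "\<And>i j y. i \<in> Basis \<Longrightarrow> j \<in> Basis \<Longrightarrow> y \<in> S \<Longrightarrow>
      partial_deriv i (p j) y = partial_deriv j (p i) y"
  shows "laplacian (\<lambda>y. \<Sum>j\<in>Basis. (p j y)\<^sup>2) x
    = 2 * (\<Sum>i\<in>Basis. \<Sum>j\<in>Basis. (partial_deriv i (p j) x)\<^sup>2)
      + 2 * (\<Sum>j\<in>Basis. p j x * partial_deriv j (\<lambda>y. \<Sum>i\<in>Basis. partial_deriv i (p i) y) x)"
proof -
  have lap: "laplacian (p j) x = partial_deriv j (\<lambda>y. \<Sum>i\<in>Basis. partial_deriv i (p i) y) x"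
    if j: "j \<in> Basis" for j
  proof -
    have "laplacian (p j) x = (\<Sum>i\<in>Basis. partial_deriv i (partial_deriv j (p i)) x)"
      unfolding laplacian_def using curl j by (intro sum.cong refl partial_deriv_cong[OF S]) auto
    also have "\<dots> = (\<Sum>i\<in>Basis. partial_deriv j (partial_deriv i (p i)) x)"
      using j p by (intro sum.cong refl partial_deriv_commute[OF S]) auto
    also have "\<dots> = partial_deriv j (\<lambda>y. \<Sum>i\<in>Basis. partial_deriv i (p i) y) x"
      using p S by (intro partial_deriv_sum[symmetric]) (auto simp: numeral_2_eq_2)
    finally show ?thesis .
  qed
  have "laplacian (\<lambda>y. \<Sum>j\<in>Basis. (p j y)\<^sup>2) x = (\<Sum>j\<in>Basis. laplacian (\<lambda>y. p j y * p j y) x)"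
    unfolding power2_eq_square using p by (intro laplacian_sum[OF S] Ck_on_mult S) auto
  also have "\<dots> = (\<Sum>j\<in>Basis. 2 * (\<Sum>i\<in>Basis. (partial_deriv i (p j) x)\<^sup>2)
      + 2 * (p j x * laplacian (p j) x))"
    using p by (intro sum.cong refl) (subst laplacian_mult[OF S], auto simp: power2_eq_square)
  also have "\<dots> = 2 * (\<Sum>j\<in>Basis. \<Sum>i\<in>Basis. (partial_deriv i (p j) x)\<^sup>2)
      + 2 * (\<Sum>j\<in>Basis. p j x * laplacian (p j) x)"
    by (simp add: sum.distrib sum_distrib_left)
  also have "(\<Sum>j\<in>Basis. \<Sum>i\<in>Basis. (partial_deriv i (p j) x)\<^sup>2)
      = (\<Sum>i\<in>Basis. \<Sum>j\<in>Basis. (partial_deriv i (p j) x)\<^sup>2)"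
    by (rule sum.swap)
  finally show ?thesis
    using lap by simp
qed

section \<open>Coercivity of the quadratic form\<close>

text \<open>The constant \<open>c = (A D - B\<^sup>2)/(A + D)\<close> is the determinant divided by the trace, which lies below the
  smaller eigenvalue.\<close>

lemma quadratic_form_coercive:
  fixes A B D :: real
  assumes "A > 0" "B\<^sup>2 < A * D"
  shows "\<exists>c>0. \<forall>x y. c * (x\<^sup>2 + y\<^sup>2) \<le> A * x\<^sup>2 - 2 * B * (x * y) + D * y\<^sup>2"
proof -
  have "A * D > 0"
    using assms(2) by (smt (verit) zero_le_power2)
  then have D: "D > 0"
    using assms(1) by (simp add: zero_less_mult_iff)
  define c where "c = (A * D - B\<^sup>2) / (A + D)"
  have c: "c > 0" "c * (A + D) = A * D - B\<^sup>2"
    using assms D by (auto simp: c_def)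
  have "(A + D) * (A - c) = A\<^sup>2 + B\<^sup>2"
    using c(2) by (simp add: algebra_simps power2_eq_square)
  moreover have "A\<^sup>2 + B\<^sup>2 > 0"
    using assms(1) by (simp add: add_pos_nonneg)
  ultimately have Ac: "A - c > 0"
    using assms(1) D by (metis add_pos_pos zero_less_mult_pos)
  have "c * (x\<^sup>2 + y\<^sup>2) \<le> A * x\<^sup>2 - 2 * B * (x * y) + D * y\<^sup>2" for x y
  proof -
    have "(A - c) * (A * x\<^sup>2 - 2 * B * (x * y) + D * y\<^sup>2 - c * (x\<^sup>2 + y\<^sup>2))
      = ((A - c) * x - B * y)\<^sup>2 + (A * D - B\<^sup>2 - c * (A + D) + c\<^sup>2) * y\<^sup>2"
      by algebra
    also have "\<dots> = ((A - c) * x - B * y)\<^sup>2 + (c * y)\<^sup>2"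
      using c(2) by (simp add: power_mult_distrib)
    also have "\<dots> \<ge> 0"
      by simp
    finally show ?thesis
      using Ac by (simp add: zero_le_mult_iff)
  qed
  with c(1) show ?thesis
    by blast
qed

text \<open>The lower bound for \<open>\<Delta>w + 2(1 + \<alpha>) p\<cdot>\<nabla>w\<close> in terms of the values of \<open>w\<close>, \<open>P = |p|\<^sup>2\<close> and
  \<open>s = \<beta> u\<^sup>-\<^sup>m\<close>. The quotient \<open>-\<Delta>u/u\<close> has been eliminated as \<open>w - \<alpha> P - s\<close>, so that what remains is a
  quadratic form; \<open>n\<close> is the dimension.\<close>

definition source :: "real \<Rightarrow> real \<Rightarrow> real \<Rightarrow> real \<Rightarrow> real \<Rightarrow> real \<Rightarrow> real \<Rightarrow> real" where
  "source n \<alpha> \<beta> m w P s = s\<^sup>2 / \<beta>\<^sup>2 + (w - \<alpha> * P - s)\<^sup>2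
     + 2 * \<alpha> * ((w - s + (1 - 2 * \<alpha>) * P)\<^sup>2 / n - \<alpha>\<^sup>2 * P\<^sup>2)
     + (m\<^sup>2 - m - 2 * \<alpha> * m) * (s * P) + m * s * (w - \<alpha> * P - s)"

lemma source_expand:
  fixes n \<alpha> \<beta> m w P s :: real
  defines "k \<equiv> 2 * \<alpha> / n"
  shows "source n \<alpha> \<beta> m w P s =
    (1 + k) * w\<^sup>2 - 2 * (\<alpha> - k * (1 - 2 * \<alpha>)) * (w * P)
    + (\<alpha>\<^sup>2 + k * (1 - 2 * \<alpha>)\<^sup>2 - 2 * \<alpha> * \<alpha>\<^sup>2) * P\<^sup>2
    + (1 / \<beta>\<^sup>2 + 1 + k - m) * s\<^sup>2 + (m - 2 - 2 * k) * (w * s)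
    + (m\<^sup>2 - (1 + 3 * \<alpha>) * m + 2 * \<alpha> - 2 * k * (1 - 2 * \<alpha>)) * (s * P)"
proof -
  have "2 * \<alpha> * ((w - s + (1 - 2 * \<alpha>) * P)\<^sup>2 / n - \<alpha>\<^sup>2 * P\<^sup>2)
      = k * (w - s + (1 - 2 * \<alpha>) * P)\<^sup>2 - 2 * \<alpha> * \<alpha>\<^sup>2 * P\<^sup>2"
    by (simp add: k_def algebra_simps)
  moreover have "s\<^sup>2 / \<beta>\<^sup>2 = 1 / \<beta>\<^sup>2 * s\<^sup>2"
    by simp
  ultimately show ?thesis
    unfolding source_def by algebra
qed

text \<open>The last three assumptions are the signs of the coefficients of \<open>s\<^sup>2\<close>, \<open>w s\<close> and \<open>s P\<close>, so these
  terms can be dropped for nonnegative arguments. With \<open>k = 2\<alpha>/n\<close> the determinant of the remaining form in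
  \<open>(w, P)\<close> is \<open>k (1 - 2\<alpha> - (n - 1)\<alpha>\<^sup>2 - 2\<alpha>\<^sup>3)\<close>, and \<open>\<alpha> (n + 3) < 2\<close> makes the second factor
  larger than \<open>(1 - 2\<alpha>)\<^sup>2 - 2\<alpha>\<^sup>3 > 0\<close>.\<close>

lemma source_coercive_alpha_pos:
  fixes n \<alpha> \<beta> m :: real
  assumes n: "n \<ge> 3" and \<alpha>: "\<alpha> > 0" "\<alpha> * (n + 3) < 2"
    and ss: "m - 1 - 2 * \<alpha> / n \<le> 1 / \<beta>\<^sup>2"
    and ws: "m - 2 - 4 * \<alpha> / n \<ge> 0"
    and sP: "m\<^sup>2 - (1 + 3 * \<alpha>) * m + 2 * \<alpha> - 4 * \<alpha> / n * (1 - 2 * \<alpha>) \<ge> 0"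
  shows "\<exists>c>0. \<forall>w P s. w \<ge> 0 \<longrightarrow> P \<ge> 0 \<longrightarrow> s \<ge> 0 \<longrightarrow> c * (w\<^sup>2 + P\<^sup>2) \<le> source n \<alpha> \<beta> m w P s"
proof -
  define k where "k = 2 * \<alpha> / n"
  have k: "k > 0" "k * n = 2 * \<alpha>"
    using n \<alpha> by (auto simp: k_def)
  have a3: "\<alpha> < 1 / 3"
  proof -
    have "\<alpha> * 6 \<le> \<alpha> * (n + 3)"
      using n \<alpha> by (intro mult_left_mono) auto
    then show ?thesis
      using \<alpha> by linarith
  qed
  have pos: "1 - 2 * \<alpha> - (n - 1) * \<alpha>\<^sup>2 - 2 * \<alpha> * \<alpha>\<^sup>2 > 0"
  proof -
    have "\<alpha> * (\<alpha> * (n + 3)) < \<alpha> * 2"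
      using \<alpha> by (intro mult_strict_left_mono) auto
    then have "1 - 2 * \<alpha> - (n - 1) * \<alpha>\<^sup>2 - 2 * \<alpha> * \<alpha>\<^sup>2 > (1 - 2 * \<alpha>)\<^sup>2 - 2 * \<alpha> * \<alpha>\<^sup>2"
      by (simp add: algebra_simps power2_eq_square)
    moreover have "(1 - 2 * \<alpha>)\<^sup>2 \<ge> (1 / 3)\<^sup>2"
      using a3 by (intro power_mono) auto
    moreover have "2 * \<alpha> * \<alpha>\<^sup>2 \<le> 2 * (1 / 3) * (1 / 3)\<^sup>2"
      using a3 \<alpha> by (intro mult_mono power_mono) auto
    ultimately show ?thesis
      by (simp add: power2_eq_square)
  qed
  have "(1 + k) * (\<alpha>\<^sup>2 + k * (1 - 2 * \<alpha>)\<^sup>2 - 2 * \<alpha> * \<alpha>\<^sup>2) - (\<alpha> - k * (1 - 2 * \<alpha>))\<^sup>2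
    = k * (1 - 2 * \<alpha> - (n - 1) * \<alpha>\<^sup>2 - 2 * \<alpha> * \<alpha>\<^sup>2)"
    using k(2) by algebra
  also have "\<dots> > 0"
    using pos k by simp
  finally have "(\<alpha> - k * (1 - 2 * \<alpha>))\<^sup>2 < (1 + k) * (\<alpha>\<^sup>2 + k * (1 - 2 * \<alpha>)\<^sup>2 - 2 * \<alpha> * \<alpha>\<^sup>2)"
    by simp
  from quadratic_form_coercive[OF _ this] k obtain c where c: "c > 0"
    "\<And>w P. c * (w\<^sup>2 + P\<^sup>2) \<le> (1 + k) * w\<^sup>2 - 2 * (\<alpha> - k * (1 - 2 * \<alpha>)) * (w * P)
      + (\<alpha>\<^sup>2 + k * (1 - 2 * \<alpha>)\<^sup>2 - 2 * \<alpha> * \<alpha>\<^sup>2) * P\<^sup>2"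
    by auto
  have "c * (w\<^sup>2 + P\<^sup>2) \<le> source n \<alpha> \<beta> m w P s" if "w \<ge> 0" "P \<ge> 0" "s \<ge> 0" for w P s
  proof -
    have "(1 / \<beta>\<^sup>2 + 1 + k - m) * s\<^sup>2 \<ge> 0" "(m - 2 - 2 * k) * (w * s) \<ge> 0"
      "(m\<^sup>2 - (1 + 3 * \<alpha>) * m + 2 * \<alpha> - 2 * k * (1 - 2 * \<alpha>)) * (s * P) \<ge> 0"
      using that ss ws sP by (auto simp: k_def)
    with c(2)[of w P] show ?thesis
      unfolding source_expand k_def[symmetric] by linarith
  qed
  with c(1) show ?thesis
    by blast
qed

text \<open>The assumptions are those for \<open>\<alpha> = 0\<close>, while the form is taken at the parameter \<open>e = 1/(2n)\<close>. When
  \<open>m\<close> equals 2, the coefficient of \<open>w s\<close> is then negative, \<open>-2k\<close> with \<open>k = 2e/n\<close>; but the coefficients of \<open>w\<^sup>2\<close> and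
  \<open>s\<^sup>2\<close> exceed their values at parameter 0 by \<open>k\<close> each, and \<open>k (w - s)\<^sup>2\<close> collects these three
  contributions.\<close>

lemma source_coercive_alpha_zero:
  fixes n \<beta> m :: real
  assumes n: "n \<ge> 3" and m: "m \<ge> 2" and ss: "m - 1 \<le> 1 / \<beta>\<^sup>2"
  shows "\<exists>c>0. \<forall>w P s. w \<ge> 0 \<longrightarrow> P \<ge> 0 \<longrightarrow> s \<ge> 0 \<longrightarrow>
    c * (w\<^sup>2 + P\<^sup>2) \<le> source n (1 / (2 * n)) \<beta> m w P s"
proof -
  define e where "e = 1 / (2 * n)"
  define k where "k = 2 * e / n"
  have e: "e > 0" "e \<le> 1 / 6"
    using n by (auto simp: e_def field_simps)
  have k_eq: "k = 4 * e\<^sup>2"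
    using n by (simp add: k_def e_def field_simps power2_eq_square)
  have k: "k > 0" "k \<le> e"
    using e mult_right_mono[of e "1/6" e] by (simp_all add: k_eq power2_eq_square)
  define B where "B = e - k * (1 - 2 * e)"
  have B: "0 \<le> B" "B \<le> e"
  proof -
    have "k * (1 - 2 * e) \<le> e * 1"
      using k e by (intro mult_mono) auto
    moreover have "k * (1 - 2 * e) \<ge> 0"
      using k e by simp
    ultimately show "0 \<le> B" "B \<le> e"
      by (simp_all add: B_def)
  qed
  have "B\<^sup>2 \<le> e\<^sup>2"
    using B by (simp add: power_mono)
  also have "e\<^sup>2 < e\<^sup>2 + k * (1 - 2 * e)\<^sup>2 - 2 * e * e\<^sup>2"
  proof -
    have "(1 - 2 * e)\<^sup>2 \<ge> (2 / 3)\<^sup>2"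
      using e by (intro power_mono) auto
    then have "4 * (1 - 2 * e)\<^sup>2 - 2 * e > 0"
      using e by (simp add: power2_eq_square)
    then have "e\<^sup>2 * (4 * (1 - 2 * e)\<^sup>2 - 2 * e) > 0"
      using e by simp
    then show ?thesis
      by (simp add: k_eq algebra_simps)
  qed
  finally have "B\<^sup>2 < 1 * (e\<^sup>2 + k * (1 - 2 * e)\<^sup>2 - 2 * e * e\<^sup>2)"
    by simp
  from quadratic_form_coercive[OF _ this] obtain c where c: "c > 0"
    "\<And>w P. c * (w\<^sup>2 + P\<^sup>2) \<le> w\<^sup>2 - 2 * B * (w * P) + (e\<^sup>2 + k * (1 - 2 * e)\<^sup>2 - 2 * e * e\<^sup>2) * P\<^sup>2"
    by auto
  have sP: "m\<^sup>2 - (1 + 3 * e) * m + 2 * e - 2 * k * (1 - 2 * e) \<ge> 0"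
  proof -
    have "m * (m - (1 + 3 * e)) \<ge> 0"
      using m e by simp
    then show ?thesis
      using B by (simp add: B_def algebra_simps power2_eq_square)
  qed
  have "c * (w\<^sup>2 + P\<^sup>2) \<le> source n e \<beta> m w P s" if "w \<ge> 0" "P \<ge> 0" "s \<ge> 0" for w P s
  proof -
    have "(m\<^sup>2 - (1 + 3 * e) * m + 2 * e - 2 * k * (1 - 2 * e)) * (s * P) \<ge> 0"
      "(m - 2) * (w * s) \<ge> 0" "(1 / \<beta>\<^sup>2 + 1 - m) * s\<^sup>2 \<ge> 0" "k * (w - s)\<^sup>2 \<ge> 0"
      using that sP m ss k by auto
    moreover have "source n e \<beta> m w P s
      = (w\<^sup>2 - 2 * B * (w * P) + (e\<^sup>2 + k * (1 - 2 * e)\<^sup>2 - 2 * e * e\<^sup>2) * P\<^sup>2)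
        + k * (w - s)\<^sup>2 + (1 / \<beta>\<^sup>2 + 1 - m) * s\<^sup>2 + (m - 2) * (w * s)
        + (m\<^sup>2 - (1 + 3 * e) * m + 2 * e - 2 * k * (1 - 2 * e)) * (s * P)"
      unfolding source_expand k_def[symmetric] B_def by (simp add: algebra_simps power2_eq_square)
    ultimately show ?thesis
      using c(2)[of w P] by linarith
  qed
  with c(1) show ?thesis
    unfolding e_def by blast
qed

text \<open>The right-hand side of the assumption is the positive root of \<open>8\<alpha>\<^sup>2 + (n\<^sup>2 + 4n - 4)\<alpha> = 2n\<close>. The
  conclusion is weaker, but it is convenient and suffices for positive definiteness.\<close>

lemma alpha_mult_dim_bound:
  fixes n \<alpha> :: real
  assumes "n \<ge> 4" "\<alpha> \<ge> 0"
    "\<alpha> < (- (n\<^sup>2 + 4 * n - 4) + sqrt ((n\<^sup>2 + 4 * n - 4)\<^sup>2 + 64 * n)) / 16"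
  shows "\<alpha> * (n + 3) < 2"
proof -
  define B where "B = n\<^sup>2 + 4 * n - 4"
  have nn: "n\<^sup>2 \<ge> 4 * n"
    using assms(1) by (simp add: power2_eq_square)
  have B: "B > 0"
    using nn assms(1) by (simp add: B_def)
  have "16 * \<alpha> + B < sqrt (B\<^sup>2 + 64 * n)"
    using assms(3) by (simp add: B_def)
  then have "(16 * \<alpha> + B)\<^sup>2 < (sqrt (B\<^sup>2 + 64 * n))\<^sup>2"
    using assms(2) B by (intro power_strict_mono) auto
  also have "\<dots> = B\<^sup>2 + 64 * n"
    using assms(1) by (intro real_sqrt_pow2) (auto intro: add_nonneg_nonneg)
  finally have "8 * \<alpha>\<^sup>2 + B * \<alpha> < 2 * n"
    by (simp add: power2_eq_square algebra_simps)
  then have "B * \<alpha> < 2 * n"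
    using zero_le_power2[of \<alpha>] by linarith
  moreover have "n * (n + 3) * \<alpha> \<le> B * \<alpha>"
    using assms(1,2) by (intro mult_right_mono) (auto simp: B_def algebra_simps power2_eq_square)
  ultimately have "n * (\<alpha> * (n + 3)) < n * 2"
    by (simp add: algebra_simps)
  then show ?thesis
    using assms(1) by simp
qed

text \<open>Squaring out the roots turns the assumptions on \<open>\<beta>\<close> and \<open>q\<close> into signs of coefficients of
  \<open>source\<close>. The parameter \<open>\<gamma>\<close> is \<open>\<alpha>\<close> itself unless \<open>\<alpha> = 0\<close>.\<close>

lemma source_coercive:
  fixes n \<alpha> \<beta> q :: real
  assumes n: "n \<ge> 3" and \<alpha>: "\<alpha> \<ge> 0" "\<alpha> * (n + 3) < 2" and \<beta>: "\<beta> > 0"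
    and \<beta>_le: "\<beta> \<le> sqrt (2 / (q - 1 - 4 * \<alpha> / n))"
    and q1: "q \<ge> 8 * \<alpha> / n + 3"
    and q2: "q \<ge> 3 * \<alpha> + sqrt (9 * \<alpha>\<^sup>2 + (1 - 2 * \<alpha>) * (1 + 16 * \<alpha> / n))"
  obtains \<gamma> c where "\<gamma> \<ge> \<alpha>" "\<gamma> > 0" "c > 0"
    "\<And>w P s. w \<ge> 0 \<Longrightarrow> P \<ge> 0 \<Longrightarrow> s \<ge> 0 \<Longrightarrow>
      c * (w\<^sup>2 + P\<^sup>2) \<le> source n \<gamma> \<beta> ((q + 1) / 2) w P s"
proof -
  define m where "m = (q + 1) / 2"
  have an: "\<alpha> / n \<ge> 0"
    using n \<alpha> by simp
  have qpos: "q - 1 - 4 * \<alpha> / n > 0"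
    using q1 an by simp
  have "\<beta>\<^sup>2 \<le> (sqrt (2 / (q - 1 - 4 * \<alpha> / n)))\<^sup>2"
    using \<beta> \<beta>_le by (intro power_mono) auto
  also have "\<dots> = 2 / (q - 1 - 4 * \<alpha> / n)"
    using qpos by simp
  finally have "(q - 1 - 4 * \<alpha> / n) / 2 \<le> 1 / \<beta>\<^sup>2"
    using qpos \<beta> by (simp add: field_simps)
  then have ss: "m - 1 - 2 * \<alpha> / n \<le> 1 / \<beta>\<^sup>2"
    by (simp add: m_def field_simps)
  have ws: "m - 2 - 4 * \<alpha> / n \<ge> 0"
    using q1 by (simp add: m_def field_simps)
  show ?thesis
  proof (cases "\<alpha> = 0")
    case True
    have "m \<ge> 2" "m - 1 \<le> 1 / \<beta>\<^sup>2"
      using ws ss True by auto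
    from source_coercive_alpha_zero[OF n this] obtain c where "c > 0"
      "\<And>w P s. w \<ge> 0 \<Longrightarrow> P \<ge> 0 \<Longrightarrow> s \<ge> 0 \<Longrightarrow>
        c * (w\<^sup>2 + P\<^sup>2) \<le> source n (1 / (2 * n)) \<beta> m w P s"
      by auto
    then show ?thesis
      using n True by (intro that[of "1 / (2 * n)" c]) (auto simp: m_def)
  next
    case False
    have "\<alpha> * 6 \<le> \<alpha> * (n + 3)"
      using n \<alpha> by (intro mult_left_mono) auto
    then have a3: "\<alpha> < 1 / 3"
      using \<alpha> by linarith
    let ?E = "9 * \<alpha>\<^sup>2 + (1 - 2 * \<alpha>) * (1 + 16 * \<alpha> / n)"
    have "?E \<ge> 0"
      using a3 \<alpha> n by (intro add_nonneg_nonneg mult_nonneg_nonneg) auto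
    then have "?E = (sqrt ?E)\<^sup>2"
      by simp
    also have "\<dots> \<le> (q - 3 * \<alpha>)\<^sup>2"
      using q2 \<open>?E \<ge> 0\<close> by (intro power_mono) auto
    finally have "q\<^sup>2 - 6 * \<alpha> * q - (1 - 2 * \<alpha>) * (1 + 16 * (\<alpha> / n)) \<ge> 0"
      by (simp add: algebra_simps power2_eq_square)
    moreover have "4 * (m\<^sup>2 - (1 + 3 * \<alpha>) * m + 2 * \<alpha> - 4 * (\<alpha> / n) * (1 - 2 * \<alpha>))
        = q\<^sup>2 - 6 * \<alpha> * q - (1 - 2 * \<alpha>) * (1 + 16 * (\<alpha> / n))"
      unfolding m_def by (simp add: field_simps power2_eq_square)
    ultimately have "m\<^sup>2 - (1 + 3 * \<alpha>) * m + 2 * \<alpha> - 4 * \<alpha> / n * (1 - 2 * \<alpha>) \<ge> 0"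
      by simp
    from source_coercive_alpha_pos[OF n _ \<alpha>(2) ss ws this] False \<alpha> obtain c where "c > 0"
      "\<And>w P s. w \<ge> 0 \<Longrightarrow> P \<ge> 0 \<Longrightarrow> s \<ge> 0 \<Longrightarrow> c * (w\<^sup>2 + P\<^sup>2) \<le> source n \<alpha> \<beta> m w P s"
      by auto
    then show ?thesis
      using False \<alpha> by (intro that[of \<alpha> c]) (auto simp: m_def)
  qed
qed

section \<open>A Keller--Osserman interior estimate\<close>

text \<open>Young's inequality. Each of the two terms on the right costs \<open>c M\<^sup>2/4\<close>; the remainder
  \<open>B\<^sup>2\<rho>\<^sup>2X\<^sup>2/c\<close> of the second one is absorbed by \<open>c X\<^sup>4\<close>. What is left is \<open>c M\<^sup>2/2\<close> bounded by a
  multiple of \<open>\<rho>\<^sup>4\<close>.\<close>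

lemma absorb_lower_order:
  fixes c A B \<rho> X M :: real
  assumes c: "c > 0" and "c * (M\<^sup>2 + X^4) \<le> A * \<rho>\<^sup>2 * M + B * \<rho> * X * M"
  shows "M \<le> sqrt (2 * A\<^sup>2 / c\<^sup>2 + B^4 / (2 * c^4)) * \<rho>\<^sup>2"
proof -
  have "0 \<le> c * (c * M / 2 - A * \<rho>\<^sup>2)\<^sup>2 / c\<^sup>2"
    using c by simp
  also have "\<dots> = c * M\<^sup>2 / 4 - A * \<rho>\<^sup>2 * M + A\<^sup>2 * \<rho>^4 / c"
    using c by (simp add: field_simps power2_eq_square power4_eq_xxxx)
  finally have 1: "A * \<rho>\<^sup>2 * M \<le> c * M\<^sup>2 / 4 + A\<^sup>2 * \<rho>^4 / c"
    by simp
  have "0 \<le> (c * M / 2 - B * \<rho> * X)\<^sup>2 / c"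
    using c by simp
  also have "\<dots> = c * M\<^sup>2 / 4 - B * \<rho> * X * M + B\<^sup>2 * \<rho>\<^sup>2 * X\<^sup>2 / c"
    using c by (simp add: field_simps power2_eq_square)
  finally have 2: "B * \<rho> * X * M \<le> c * M\<^sup>2 / 4 + B\<^sup>2 * \<rho>\<^sup>2 * X\<^sup>2 / c"
    by simp
  have "0 \<le> (2 * c\<^sup>2 * X\<^sup>2 - B\<^sup>2 * \<rho>\<^sup>2)\<^sup>2 / (4 * c^3)"
    using c by simp
  also have "\<dots> = c * X^4 - B\<^sup>2 * \<rho>\<^sup>2 * X\<^sup>2 / c + B^4 * \<rho>^4 / (4 * c^3)"
    using c by (simp add: field_simps power2_eq_square power4_eq_xxxx power3_eq_cube)
  finally have 3: "B\<^sup>2 * \<rho>\<^sup>2 * X\<^sup>2 / c \<le> c * X^4 + B^4 * \<rho>^4 / (4 * c^3)"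
    by simp
  have "c * M\<^sup>2 / 2 \<le> A\<^sup>2 * \<rho>^4 / c + B^4 * \<rho>^4 / (4 * c^3)"
    using 1 2 3 assms(2) by (simp add: distrib_left)
  then have "2 / c * (c * M\<^sup>2 / 2) \<le> 2 / c * (A\<^sup>2 * \<rho>^4 / c + B^4 * \<rho>^4 / (4 * c^3))"
    using c by (intro mult_left_mono) auto
  also have "\<dots> = (2 * A\<^sup>2 / c\<^sup>2 + B^4 / (2 * c^4)) * (\<rho>\<^sup>2)\<^sup>2"
    using c by (simp add: field_simps power2_eq_square power4_eq_xxxx power3_eq_cube)
  also have "2 / c * (c * M\<^sup>2 / 2) = M\<^sup>2"
    using c by simp
  finally have "M \<le> sqrt ((2 * A\<^sup>2 / c\<^sup>2 + B^4 / (2 * c^4)) * (\<rho>\<^sup>2)\<^sup>2)"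
    by (rule real_le_rsqrt)
  then show ?thesis
    by (simp only: real_sqrt_mult real_sqrt_abs abs_power2)
qed

lemma partial_deriv_paraboloid:
  fixes x0 :: "'a::euclidean_space" and \<rho> :: real
  defines "\<zeta> \<equiv> \<lambda>x. \<rho>\<^sup>2 - (x - x0) \<bullet> (x - x0)"
  shows "\<zeta> differentiable (at x)" and "partial_deriv b \<zeta> = (\<lambda>x. -2 * ((x - x0) \<bullet> b))"
proof -
  have d: "(\<zeta> has_derivative (\<lambda>h. -2 * ((x - x0) \<bullet> h))) (at x)" for x
    unfolding \<zeta>_def by (auto intro!: derivative_eq_intros simp: inner_commute algebra_simps)
  then show "\<zeta> differentiable (at x)"
    by (rule differentiableI)
  show "partial_deriv b \<zeta> = (\<lambda>x. -2 * ((x - x0) \<bullet> b))"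
    using partial_deriv_eqI[OF d] by (simp add: fun_eq_iff)
qed

lemma partial_deriv2_paraboloid:
  fixes x0 :: "'a::euclidean_space"
  shows "(\<lambda>x. -2 * ((x - x0) \<bullet> b)) differentiable (at x)"
    and "partial_deriv c (\<lambda>x. -2 * ((x - x0) \<bullet> b)) = (\<lambda>x. -2 * (c \<bullet> b))"
proof -
  have d: "((\<lambda>x. -2 * ((x - x0) \<bullet> b)) has_derivative (\<lambda>h. -2 * (h \<bullet> b))) (at x)" for x
    by (auto intro!: derivative_eq_intros)
  then show "(\<lambda>x. -2 * ((x - x0) \<bullet> b)) differentiable (at x)"
    by (rule differentiableI)
  show "partial_deriv c (\<lambda>x. -2 * ((x - x0) \<bullet> b)) = (\<lambda>x. -2 * (c \<bullet> b))"
    using partial_deriv_eqI[OF d] by (simp add: fun_eq_iff)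
qed

lemma Ck_on_paraboloid:
  fixes x0 :: "'a::euclidean_space"
  shows "Ck_on 2 (\<lambda>x. \<rho>\<^sup>2 - (x - x0) \<bullet> (x - x0)) S"
proof -
  have "Ck_on (Suc (Suc 0)) (\<lambda>x. \<rho>\<^sup>2 - (x - x0) \<bullet> (x - x0)) S"
    unfolding Ck_on.simps partial_deriv_paraboloid(2) partial_deriv2_paraboloid(2)
    by (intro ballI conjI partial_deriv_paraboloid(1) partial_deriv2_paraboloid(1) continuous_on_const)
  then show ?thesis
    by (simp only: numeral_2_eq_2)
qed

text \<open>With \<open>r = |x - x\<^sub>0|\<close>, one has \<open>\<Delta>\<zeta>\<^sup>-\<^sup>2 = 4n \<zeta>\<^sup>-\<^sup>3 + 24 r\<^sup>2 \<zeta>\<^sup>-\<^sup>4\<close> in dimension \<open>n\<close> and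
  \<open>\<nabla>\<zeta>\<^sup>-\<^sup>2 = 4 \<zeta>\<^sup>-\<^sup>3 (x - x\<^sub>0)\<close>; the bounds follow from \<open>\<zeta> \<le> \<rho>\<^sup>2\<close> and \<open>r \<le> \<rho>\<close>.\<close>

lemma inverse_square_barrier:
  fixes x0 x V :: "'a::euclidean_space" and \<rho> :: real
  defines "\<zeta> \<equiv> \<lambda>x. \<rho>\<^sup>2 - (x - x0) \<bullet> (x - x0)"
  defines "g \<equiv> \<lambda>x. \<zeta> x powr (-2)"
  assumes \<rho>: "\<rho> > 0" and x: "x \<in> ball x0 \<rho>"
  shows "\<zeta> x > 0" and "g x = 1 / (\<zeta> x)\<^sup>2" and "Ck_on 2 g (ball x0 \<rho>)"
    and "laplacian g x \<le> 4 * (real DIM('a) + 6) * \<rho>\<^sup>2 / \<zeta> x ^ 4"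
    and "V \<bullet> gradient g x \<le> 4 * norm V * \<rho> / \<zeta> x ^ 3"
proof -
  have pos: "\<zeta> y > 0" if "y \<in> ball x0 \<rho>" for y
  proof -
    have "(norm (y - x0))\<^sup>2 < \<rho>\<^sup>2"
      using that \<rho> by (intro power_strict_mono) (auto simp: dist_norm norm_minus_commute)
    then show ?thesis
      by (simp add: \<zeta>_def power2_norm_eq_inner)
  qed
  note S = open_ball x
  show z: "\<zeta> x > 0"
    using pos x .
  have z_le: "\<zeta> x \<le> \<rho>\<^sup>2"
    by (simp add: \<zeta>_def)
  have r_less: "norm (x - x0) \<le> \<rho>"
    using x by (simp add: dist_norm norm_minus_commute)
  have z4: "\<zeta> x powr (-4) = 1 / \<zeta> x ^ 4" and z3: "\<zeta> x powr (-3) = 1 / \<zeta> x ^ 3"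
    and z2: "\<zeta> x powr (-2) = 1 / (\<zeta> x)\<^sup>2"
    using z powr_numeral[of "\<zeta> x"] by (simp_all add: powr_minus_divide)
  show "g x = 1 / (\<zeta> x)\<^sup>2"
    by (simp add: g_def z2)
  have C2: "Ck_on 2 \<zeta> (ball x0 \<rho>)"
    unfolding \<zeta>_def by (rule Ck_on_paraboloid)
  then show "Ck_on 2 g (ball x0 \<rho>)"
    unfolding g_def using pos by (intro Ck_on_powr open_ball) auto
  have D: "partial_deriv b \<zeta> = (\<lambda>x. -2 * ((x - x0) \<bullet> b))" for b
    unfolding \<zeta>_def by (rule partial_deriv_paraboloid)
  have lap: "laplacian \<zeta> x = -2 * DIM('a)"
    unfolding laplacian_def D partial_deriv2_paraboloid by simp
  have grad: "(\<Sum>b\<in>Basis. (partial_deriv b \<zeta> x)\<^sup>2) = 4 * (norm (x - x0))\<^sup>2"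
  proof -
    have "(\<Sum>b\<in>Basis. (partial_deriv b \<zeta> x)\<^sup>2) = 4 * (\<Sum>b\<in>Basis. ((x - x0) \<bullet> b) * ((x - x0) \<bullet> b))"
      by (simp add: D sum_distrib_left power2_eq_square)
    then show ?thesis
      by (simp add: power2_norm_eq_inner euclidean_inner[of "x - x0" "x - x0"])
  qed
  have "laplacian g x = 4 * DIM('a) * \<zeta> x / \<zeta> x ^ 4 + 24 * (norm (x - x0))\<^sup>2 / \<zeta> x ^ 4"
    unfolding g_def using z laplacian_powr[OF S C2 pos, of "-2"]
    by (simp add: lap grad z3 z4) (simp add: power_eq_if)
  also have "\<dots> \<le> 4 * DIM('a) * \<rho>\<^sup>2 / \<zeta> x ^ 4 + 24 * \<rho>\<^sup>2 / \<zeta> x ^ 4"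
    using z z_le r_less by (intro add_mono divide_right_mono mult_left_mono power_mono) auto
  also have "\<dots> = 4 * (real DIM('a) + 6) * \<rho>\<^sup>2 / \<zeta> x ^ 4"
    by (simp add: add_divide_distrib algebra_simps)
  finally show "laplacian g x \<le> 4 * (real DIM('a) + 6) * \<rho>\<^sup>2 / \<zeta> x ^ 4" .
  have Dg: "partial_deriv b g x = 4 / \<zeta> x ^ 3 * ((x - x0) \<bullet> b)" for b
    unfolding g_def using z partial_deriv_powr[of \<zeta> x b "-2"] Ck_on_differentiable[OF C2 _ x]
    by (simp add: D z3)
  have "V \<bullet> gradient g x = (\<Sum>b\<in>Basis. (V \<bullet> b) * (4 / \<zeta> x ^ 3 * ((x - x0) \<bullet> b)))"
    by (subst euclidean_inner) (simp add: inner_gradient Dg)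
  also have "\<dots> = 4 / \<zeta> x ^ 3 * (V \<bullet> (x - x0))"
    by (subst (2) euclidean_inner) (simp add: sum_distrib_left ac_simps)
  also have "V \<bullet> (x - x0) \<le> norm V * \<rho>"
    using norm_cauchy_schwarz[of V "x - x0"] mult_left_mono[OF r_less, of "norm V"] by simp
  then have "4 / \<zeta> x ^ 3 * (V \<bullet> (x - x0)) \<le> 4 / \<zeta> x ^ 3 * (norm V * \<rho>)"
    using z by (intro mult_left_mono) auto
  finally show "V \<bullet> gradient g x \<le> 4 * norm V * \<rho> / \<zeta> x ^ 3"
    by simp
qed

text \<open>The contact-point argument: with \<open>M\<close> the maximum of \<open>w \<zeta>\<^sup>2\<close>, the difference \<open>w - M \<zeta>\<^sup>-\<^sup>2\<close> has an interior
  maximum, so that the inequality for \<open>w\<close> becomes one for the explicit function \<open>\<zeta>\<^sup>-\<^sup>2\<close>. The factor \<open>\<zeta>\<^sup>2\<close>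
  forces the maximum into the open ball, and the term \<open>|V|\<^sup>4\<close> makes the constant independent of the drift
  field \<open>V\<close>.\<close>

lemma interior_estimate:
  fixes w :: "'a::euclidean_space \<Rightarrow> real" and V :: "'a \<Rightarrow> 'a"
  assumes \<rho>: "\<rho> > 0" and c: "c > 0" and K: "K \<ge> 0"
    and cont: "continuous_on (cball x0 \<rho>) w" and C2: "Ck_on 2 w (ball x0 \<rho>)"
    and ineq: "\<And>x. x \<in> ball x0 \<rho> \<Longrightarrow> w x \<ge> 0 \<Longrightarrow>
      c * ((w x)\<^sup>2 + norm (V x) ^ 4) \<le> laplacian w x + K * (V x \<bullet> gradient w x)"
    and x: "x \<in> ball x0 \<rho>"
  shows "w x * (\<rho>\<^sup>2 - (norm (x - x0))\<^sup>2)\<^sup>2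
    \<le> sqrt (2 * (4 * (real DIM('a) + 6))\<^sup>2 / c\<^sup>2 + (4 * K)^4 / (2 * c^4)) * \<rho>\<^sup>2"
proof -
  define \<zeta> where "\<zeta> x = \<rho>\<^sup>2 - (x - x0) \<bullet> (x - x0)" for x
  define g where "g x = \<zeta> x powr (-2)" for x
  define L where "L = sqrt (2 * (4 * (real DIM('a) + 6))\<^sup>2 / c\<^sup>2 + (4 * K)^4 / (2 * c^4))"
  have "L \<ge> 0"
    unfolding L_def using c K by (intro real_sqrt_ge_zero add_nonneg_nonneg) auto
  note b = inverse_square_barrier[OF \<rho>, of _ x0, folded \<zeta>_def, folded g_def]
  have cont': "continuous_on (cball x0 \<rho>) (\<lambda>x. w x * (\<zeta> x)\<^sup>2)"
    unfolding \<zeta>_def by (intro continuous_intros cont)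
  have "cball x0 \<rho> \<noteq> {}"
    using \<rho> by simp
  from continuous_attains_sup[OF compact_cball this cont'] obtain y where y: "y \<in> cball x0 \<rho>" and
    max: "\<And>x. x \<in> cball x0 \<rho> \<Longrightarrow> w x * (\<zeta> x)\<^sup>2 \<le> w y * (\<zeta> y)\<^sup>2"
    by blast
  define M where "M = w y * (\<zeta> y)\<^sup>2"
  have "M \<le> L * \<rho>\<^sup>2"
  proof (cases "M \<le> 0")
    case True
    then show ?thesis
      using \<open>L \<ge> 0\<close> by (meson mult_nonneg_nonneg order_trans zero_le_power2)
  next
    case False
    then have M: "M > 0" by simp
    have yb: "y \<in> ball x0 \<rho>"
    proof (rule ccontr)
      assume "y \<notin> ball x0 \<rho>"
      then have "norm (y - x0) = \<rho>"
        using y by (simp add: dist_norm norm_minus_commute)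
      then have "\<zeta> y = 0"
        by (simp add: \<zeta>_def power2_norm_eq_inner[symmetric])
      with M show False
        by (simp add: M_def)
    qed
    define z where "z = \<zeta> y"
    have z: "z > 0"
      using b(1)[OF yb] by (simp add: z_def)
    have wy: "w y = M / z\<^sup>2"
      using z by (simp add: M_def z_def)
    \<comment> \<open>The function \<open>M \<zeta>\<^sup>-\<^sup>2\<close> lies above \<open>w\<close> in the ball and touches it at \<open>y\<close>.\<close>
    define G where "G = (\<lambda>x. w x + (- M) * g x)"
    have gC2: "Ck_on 2 g (ball x0 \<rho>)"
      by (rule b(3)[OF yb])
    have GC2: "Ck_on 2 G (ball x0 \<rho>)"
      unfolding G_def by (intro Ck_on_add Ck_on_cmult open_ball C2 gC2)
    have Gmax: "G x \<le> G y" if "x \<in> ball x0 \<rho>" for x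
    proof -
      have "w x * (\<zeta> x)\<^sup>2 \<le> M"
        using max that by (simp add: M_def)
      then have "w x \<le> M / (\<zeta> x)\<^sup>2"
        using b(1)[OF that] by (simp add: field_simps)
      then have "G x \<le> 0"
        by (simp add: G_def b(2)[OF that])
      moreover have "G y = 0"
        by (simp add: G_def b(2)[OF yb] wy z_def)
      ultimately show ?thesis by simp
    qed
    have mx: "partial_deriv b G y = 0" "partial_deriv b (partial_deriv b G) y \<le> 0"
      if "b \<in> Basis" for b
      using partial_derivs_at_max[OF open_ball yb GC2 that] Gmax by auto
    have dw: "w differentiable (at y)" and dg: "g differentiable (at y)"
      using Ck_on_differentiable[OF C2 _ yb] Ck_on_differentiable[OF gC2 _ yb] by auto
    have grad: "gradient w y = M *\<^sub>R gradient g y"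
    proof -
      have "partial_deriv b w y = M * partial_deriv b g y" if "b \<in> Basis" for b
      proof -
        have "0 = partial_deriv b w y + partial_deriv b (\<lambda>x. (- M) * g x) y"
          unfolding mx(1)[OF that, symmetric] unfolding G_def
          using dg by (intro partial_deriv_add dw differentiable_mult) auto
        also have "\<dots> = partial_deriv b w y + (- M) * partial_deriv b g y"
          by (simp only: partial_deriv_cmult[OF dg])
        finally show ?thesis
          by simp
      qed
      then show ?thesis
        by (simp add: gradient_def scaleR_sum_right)
    qed
    have "laplacian G y \<le> 0"
      unfolding laplacian_def using mx(2) by (intro sum_nonpos) auto
    then have lap: "laplacian w y \<le> M * laplacian g y"
      unfolding G_def
      by (subst (asm) laplacian_add[OF open_ball yb C2 Ck_on_cmult[OF open_ball gC2]],
          subst (asm) laplacian_cmult[OF open_ball yb gC2]) simp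
    define N where "N = norm (V y)"
    have "c * ((M / z\<^sup>2)\<^sup>2 + N ^ 4) \<le> M * laplacian g y + K * (M * (V y \<bullet> gradient g y))"
      using ineq[OF yb] lap M z by (simp add: wy N_def grad)
    also have "\<dots> \<le> M * (4 * (real DIM('a) + 6) * \<rho>\<^sup>2 / z ^ 4) + K * (M * (4 * N * \<rho> / z ^ 3))"
      using b(4,5)[OF yb] M K by (intro add_mono mult_left_mono) (auto simp: N_def z_def)
    \<comment> \<open>Multiplying by \<open>z\<^sup>4\<close> makes the inequality homogeneous in \<open>M\<close>, \<open>X\<^sup>2\<close> and \<open>\<rho>\<^sup>2\<close> with \<open>X = |V| z\<close>.\<close>
    finally have "z ^ 4 * (c * ((M / z\<^sup>2)\<^sup>2 + N ^ 4))
        \<le> z ^ 4 * (M * (4 * (real DIM('a) + 6) * \<rho>\<^sup>2 / z ^ 4) + K * (M * (4 * N * \<rho> / z ^ 3)))"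
      using z by (intro mult_left_mono) auto
    also have "z ^ 4 * (c * ((M / z\<^sup>2)\<^sup>2 + N ^ 4)) = c * (M\<^sup>2 + (N * z) ^ 4)"
      using z by (simp add: field_simps power2_eq_square power4_eq_xxxx)
    also have "z ^ 4 * (M * (4 * (real DIM('a) + 6) * \<rho>\<^sup>2 / z ^ 4) + K * (M * (4 * N * \<rho> / z ^ 3)))
        = (4 * (real DIM('a) + 6)) * \<rho>\<^sup>2 * M + (4 * K) * \<rho> * (N * z) * M"
      using z by (simp add: field_simps power3_eq_cube power4_eq_xxxx)
    finally show ?thesis
      unfolding L_def by (intro absorb_lower_order[OF c]) simp
  qed
  moreover have "w x * (\<zeta> x)\<^sup>2 \<le> M"
    using max x by (simp add: M_def)
  ultimately show ?thesis
    by (simp add: L_def \<zeta>_def power2_norm_eq_inner)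
qed

section \<open>The differential inequality and the gradient estimate\<close>

text \<open>Apply the product rule to \<open>-\<Delta>u = a u\<close>. The term \<open>a \<Delta>u = -a\<^sup>2 u\<close> is what makes the right-hand
  side quadratic in \<open>a\<close>.\<close>

lemma laplacian_quotient:
  assumes S: "open S" "x \<in> S" and u: "Ck_on 4 u S" and pos: "\<And>y. y \<in> S \<Longrightarrow> u y > 0"
  defines "a \<equiv> \<lambda>y. - laplacian u y / u y"
  shows "Ck_on 2 a S" and "laplacian a x
    = - bilaplacian u x / u x - 2 * (\<Sum>b\<in>Basis. partial_deriv b u x / u x * partial_deriv b a x) + (a x)\<^sup>2"
proof -
  have u2: "Ck_on 2 u S"
    using Ck_on_le[OF u] by simp
  have "Ck_on (Suc (Suc 2)) u S"
    using u by (simp add: numeral_eq_Suc)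
  then have lap_u: "Ck_on 2 (laplacian u) S"
    unfolding laplacian_def by (intro Ck_on_sum S Ck_on_partial_deriv)
  have v: "Ck_on 2 (\<lambda>y. - laplacian u y) S"
    using Ck_on_cmult[OF S(1) lap_u, of "-1"] by simp
  show a: "Ck_on 2 a S"
    unfolding a_def by (rule Ck_on_divide[OF S(1) v u2 pos])
  have ux: "u x > 0"
    using pos S by simp
  have "- bilaplacian u x = laplacian (\<lambda>y. - laplacian u y) x"
    using laplacian_cmult[OF S lap_u, of "-1"] by (simp add: bilaplacian_def)
  also have "\<dots> = laplacian (\<lambda>y. a y * u y) x"
    using pos by (intro laplacian_cong[OF S]) (force simp: a_def)
  also have "\<dots> = laplacian a x * u x + 2 * (\<Sum>b\<in>Basis. partial_deriv b a x * partial_deriv b u x)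
      + a x * laplacian u x"
    by (rule laplacian_mult[OF S a u2])
  also have "(\<Sum>b\<in>Basis. partial_deriv b a x * partial_deriv b u x)
      = u x * (\<Sum>b\<in>Basis. partial_deriv b u x / u x * partial_deriv b a x)"
    using ux by (simp add: sum_distrib_left mult.commute)
  also have "laplacian u x = - a x * u x"
    using ux by (simp add: a_def)
  finally show "laplacian a x = - bilaplacian u x / u x
      - 2 * (\<Sum>b\<in>Basis. partial_deriv b u x / u x * partial_deriv b a x) + (a x)\<^sup>2"
    using ux by (simp add: field_simps power2_eq_square)
qed

lemma log_partial_derivs:
  fixes u :: "'a::euclidean_space \<Rightarrow> real"
  assumes S: "open S" "x \<in> S" and u: "Ck_on 3 u S" and pos: "\<And>y. y \<in> S \<Longrightarrow> u y > 0"
    and ij: "i \<in> Basis" "j \<in> Basis"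
  defines "p \<equiv> \<lambda>i y. partial_deriv i u y / u y"
  shows "Ck_on 2 (p j) S"
    and "partial_deriv i (p j) x = partial_deriv i (partial_deriv j u) x / u x - p i x * p j x"
    and "partial_deriv i (p j) x = partial_deriv j (p i) x"
proof -
  have C: "Ck_on 2 u S" "\<And>j. j \<in> Basis \<Longrightarrow> Ck_on 2 (partial_deriv j u) S"
    using Ck_on_le[OF u, of 2] u by (simp_all add: numeral_eq_Suc)
  have pC: "Ck_on 2 (p j) S" if "j \<in> Basis" for j
    unfolding p_def using C that pos by (intro Ck_on_divide[OF S(1)]) auto
  have D: "partial_deriv i (p j) x = partial_deriv i (partial_deriv j u) x / u x - p i x * p j x"
    if "i \<in> Basis" "j \<in> Basis" for i j
  proof -
    have "partial_deriv i (partial_deriv j u) x = partial_deriv i (\<lambda>y. p j y * u y) x"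
      using pos by (intro partial_deriv_cong[OF S]) (force simp: p_def)
    also have "\<dots> = partial_deriv i (p j) x * u x + p j x * partial_deriv i u x"
      using C pC that S by (intro partial_deriv_mult Ck_on_differentiable[of 2 _ S]) auto
    finally show ?thesis
      using pos[OF S(2)] by (simp add: p_def field_simps)
  qed
  show "Ck_on 2 (p j) S"
    using pC ij by simp
  show "partial_deriv i (p j) x = partial_deriv i (partial_deriv j u) x / u x - p i x * p j x"
    using D ij by simp
  show "partial_deriv i (p j) x = partial_deriv j (p i) x"
    using D ij partial_deriv_commute[OF S C(1)] by simp
qed

text \<open>Write \<open>D f = p\<cdot>\<nabla>f\<close> with \<open>p = \<nabla>u/u\<close>. The Laplacians of \<open>a\<close> and \<open>P\<close> contribute
  \<open>-2(1 + \<gamma>) D a - 2\<gamma> D P\<close>. Adding \<open>2(1 + \<gamma>) D w\<close> cancels \<open>D a\<close>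
  and leaves \<open>2\<gamma>\<^sup>2 D P\<close>, which is \<open>4\<gamma>\<^sup>2\<close> times the Hessian of \<open>log u\<close> applied to \<open>(p, p)\<close>: exactly the mixed
  term needed to complete the square in \<open>2\<gamma> |D\<^sup>2 log u|\<^sup>2\<close>.\<close>

lemma auxiliary_function_inequality:
  fixes u :: "'a::euclidean_space \<Rightarrow> real" and m \<beta> \<gamma> :: real
  defines "a \<equiv> \<lambda>y. - laplacian u y / u y"
    and "P \<equiv> \<lambda>y. \<Sum>b\<in>Basis. (partial_deriv b u y / u y)\<^sup>2"
    and "s \<equiv> \<lambda>y. \<beta> * u y powr (- m)"
  defines "w \<equiv> \<lambda>y. a y + \<gamma> * P y + s y"
  assumes S: "open S" "x \<in> S" and u: "Ck_on 4 u S" and pos: "\<And>y. y \<in> S \<Longrightarrow> u y > 0"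
    and eq: "- bilaplacian u x = u x powr (1 - 2 * m)" and \<beta>: "\<beta> \<noteq> 0" and \<gamma>: "\<gamma> \<ge> 0"
  shows "Ck_on 2 w S"
    and "source (real DIM('a)) \<gamma> \<beta> m (w x) (P x) (s x) \<le>
      laplacian w x + 2 * (1 + \<gamma>) * ((gradient u x /\<^sub>R u x) \<bullet> gradient w x)"
proof -
  define p where "p i y = partial_deriv i u y / u y" for i y
  have ux: "u x > 0"
    using pos S by simp
  have u3: "Ck_on 3 u S" and u2: "Ck_on 2 u S"
    using Ck_on_le[OF u] by simp_all
  note log = log_partial_derivs[OF S(1) _ u3 pos, folded p_def]
  have P_eq: "P = (\<lambda>y. \<Sum>b\<in>Basis. (p b y)\<^sup>2)"
    by (simp add: P_def p_def)
  have pC: "Ck_on 2 (p b) S" if "b \<in> Basis" for b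
    by (rule log(1)[OF S(2) _ that that])
  have aC: "Ck_on 2 a S"
    unfolding a_def by (rule laplacian_quotient(1)[OF S u pos])
  have PC: "Ck_on 2 P S"
    unfolding P_eq power2_eq_square using pC by (intro Ck_on_sum Ck_on_mult S(1)) auto
  have sC: "Ck_on 2 s S"
    unfolding s_def using pos by (intro Ck_on_cmult Ck_on_powr S(1) u2)
  have gPC: "Ck_on 2 (\<lambda>y. \<gamma> * P y) S" and agPC: "Ck_on 2 (\<lambda>y. a y + \<gamma> * P y) S"
    by (intro Ck_on_add Ck_on_cmult S(1) aC PC)+
  show wC: "Ck_on 2 w S"
    unfolding w_def by (intro Ck_on_add S(1) agPC sC)
  have diff: "f differentiable (at x)" if "Ck_on 2 f S" for f
    using that S(2) Ck_on_differentiable by fastforce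

  define D where "D f = (\<Sum>b\<in>Basis. p b x * partial_deriv b f x)" for f
  define H where "H i j = partial_deriv i (p j) x" for i j

  \<comment> \<open>The divergence of \<open>p = \<nabla> log u\<close> is \<open>\<Delta>u/u - |p|\<^sup>2\<close>.\<close>
  have div: "(\<Sum>i\<in>Basis. partial_deriv i (p i) y) = - a y - P y" if "y \<in> S" for y
    using log(2)[OF that]
    by (simp add: laplacian_def a_def P_eq sum_subtractf sum_divide_distrib power2_eq_square)

  have lap_a: "laplacian a x = u x powr (- 2 * m) - 2 * D a + (a x)\<^sup>2"
  proof -
    have "u x powr (1 - 2 * m) / u x = u x powr (- 2 * m)"
      using ux by (simp add: powr_diff powr_minus field_simps)
    then show ?thesis
      using laplacian_quotient(2)[OF S u pos] eq by (simp add: D_def p_def a_def)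
  qed

  have lap_P: "laplacian P x = 2 * (\<Sum>i\<in>Basis. \<Sum>j\<in>Basis. (H i j)\<^sup>2) - 2 * D a - 2 * D P"
  proof -
    have "partial_deriv j (\<lambda>y. \<Sum>i\<in>Basis. partial_deriv i (p i) y) x
        = - partial_deriv j a x - partial_deriv j P x" for j
    proof -
      have "partial_deriv j (\<lambda>y. \<Sum>i\<in>Basis. partial_deriv i (p i) y) x
          = partial_deriv j (\<lambda>y. (-1) * a y + (-1) * P y) x"
        using div by (intro partial_deriv_cong[OF S]) simp
      also have "\<dots> = (-1) * partial_deriv j a x + (-1) * partial_deriv j P x"
        using aC PC diff S(1)
        by (subst partial_deriv_add) (auto intro!: diff Ck_on_cmult simp only: partial_deriv_cmult)
      finally show ?thesis by simp
    qed
    then have "(\<Sum>j\<in>Basis. p j x * partial_deriv j (\<lambda>y. \<Sum>i\<in>Basis. partial_deriv i (p i) y) x)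
        = - D a - D P"
      by (simp add: D_def right_diff_distrib sum_subtractf sum_negf)
    moreover have "laplacian P x = 2 * (\<Sum>i\<in>Basis. \<Sum>j\<in>Basis. (H i j)\<^sup>2)
        + 2 * (\<Sum>j\<in>Basis. p j x * partial_deriv j (\<lambda>y. \<Sum>i\<in>Basis. partial_deriv i (p i) y) x)"
      unfolding P_eq H_def using pC log(3) by (intro bochner_curl_free[OF S]) auto
    ultimately show ?thesis by simp
  qed

  have D_P: "D P = 2 * (\<Sum>i\<in>Basis. \<Sum>j\<in>Basis. p i x * p j x * H i j)"
  proof -
    have "partial_deriv i P x = (\<Sum>j\<in>Basis. 2 * (p j x * H i j))" for i
    proof -
      have "partial_deriv i P x = (\<Sum>j\<in>Basis. partial_deriv i (\<lambda>y. p j y * p j y) x)"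
        unfolding P_eq power2_eq_square
        using pC S(1) by (intro partial_deriv_sum diff Ck_on_mult) auto
      also have "\<dots> = (\<Sum>j\<in>Basis. 2 * (p j x * H i j))"
        using pC diff by (intro sum.cong refl) (simp add: partial_deriv_mult H_def)
      finally show ?thesis .
    qed
    then show ?thesis
      by (simp add: D_def sum_distrib_left ac_simps)
  qed

  have lap_u: "laplacian u x = - a x * u x"
    using ux by (simp add: a_def)
  have sum_Du: "(\<Sum>b\<in>Basis. (partial_deriv b u x)\<^sup>2) = P x * (u x)\<^sup>2"
    using ux by (simp add: P_def sum_distrib_right power_divide)
  have pw: "u x powr (- m - 1) * u x = u x powr (- m)" "u x powr (- m - 2) * (u x)\<^sup>2 = u x powr (- m)"
    using ux by (simp_all add: powr_diff powr_numeral)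

  have lap_s: "laplacian s x = m * s x * a x + m * (m + 1) * s x * P x"
  proof -
    have "laplacian s x = \<beta> * laplacian (\<lambda>y. u y powr (- m)) x"
      unfolding s_def using pos by (intro laplacian_cmult[OF S] Ck_on_powr S(1) u2)
    also have "\<dots> = \<beta> * (m * a x * (u x powr (- m - 1) * u x)
        + m * (m + 1) * P x * (u x powr (- m - 2) * (u x)\<^sup>2))"
      by (subst laplacian_powr[OF S u2 pos]) (auto simp: lap_u sum_Du algebra_simps)
    also have "\<dots> = m * s x * a x + m * (m + 1) * s x * P x"
      unfolding pw by (simp add: s_def algebra_simps)
    finally show ?thesis .
  qed

  have D_s: "D s = - m * s x * P x"
  proof -
    have "partial_deriv b s x = - m * s x * p b x" for b
    proof -
      have "partial_deriv b s x = \<beta> * partial_deriv b (\<lambda>y. u y powr (- m)) x"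
        unfolding s_def using pos by (intro partial_deriv_cmult diff Ck_on_powr S(1) u2)
      also have "\<dots> = - m * \<beta> * (u x powr (- m - 1) * u x) * p b x"
        using ux by (simp add: partial_deriv_powr[OF diff[OF u2]] p_def)
      finally show ?thesis
        unfolding pw by (simp add: s_def)
    qed
    then show ?thesis
      by (simp add: D_def P_eq sum_distrib_left power2_eq_square sum_negf ac_simps)
  qed

  have lap_w: "laplacian w x = laplacian a x + \<gamma> * laplacian P x + laplacian s x"
    unfolding w_def using laplacian_add[OF S agPC sC] laplacian_add[OF S aC gPC]
      laplacian_cmult[OF S PC] by simp

  have D_w: "(gradient u x /\<^sub>R u x) \<bullet> gradient w x = D a + \<gamma> * D P + D s"
  proof -
    have "partial_deriv b w x = partial_deriv b a x + \<gamma> * partial_deriv b P x + partial_deriv b s x" for b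
      unfolding w_def using diff[OF aC] diff[OF gPC] diff[OF agPC] diff[OF sC] diff[OF PC]
      by (simp add: partial_deriv_add partial_deriv_cmult)
    then have "D w = D a + \<gamma> * D P + D s"
      by (simp add: D_def sum.distrib sum_distrib_left algebra_simps)
    moreover have "(gradient u x /\<^sub>R u x) \<bullet> gradient w x = D w"
      unfolding D_def p_def by (subst euclidean_inner) (simp add: inner_gradient divide_inverse ac_simps)
    ultimately show ?thesis by simp
  qed

  have E: "u x powr (- 2 * m) = (s x)\<^sup>2 / \<beta>\<^sup>2"
    using \<beta> by (simp add: s_def power_mult_distrib power2_eq_square[of "_ powr _"] powr_add[symmetric])

  have hess: "(- a x - P x + \<gamma> * P x)\<^sup>2 / DIM('a) - \<gamma>\<^sup>2 * (P x)\<^sup>2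
      \<le> (\<Sum>i\<in>Basis. \<Sum>j\<in>Basis. (H i j)\<^sup>2) + \<gamma> * D P"
    unfolding D_P
    using sum_squares_hessian_lower[of "Basis :: 'a set" H \<gamma> "\<lambda>i. p i x"] div[OF S(2)]
    by (simp add: H_def[symmetric] P_eq)
  have sq: "(w x - s x + (1 - 2 * \<gamma>) * P x)\<^sup>2 = (- a x - P x + \<gamma> * P x)\<^sup>2"
    by (simp add: w_def power2_eq_square algebra_simps)
  have "2 * \<gamma> * ((w x - s x + (1 - 2 * \<gamma>) * P x)\<^sup>2 / DIM('a) - \<gamma>\<^sup>2 * (P x)\<^sup>2)
      \<le> 2 * \<gamma> * ((\<Sum>i\<in>Basis. \<Sum>j\<in>Basis. (H i j)\<^sup>2) + \<gamma> * D P)"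
    unfolding sq using \<gamma> by (intro mult_left_mono hess) auto
  moreover have "laplacian w x + 2 * (1 + \<gamma>) * (D a + \<gamma> * D P + D s)
      = (s x)\<^sup>2 / \<beta>\<^sup>2 + (a x)\<^sup>2 + 2 * \<gamma> * ((\<Sum>i\<in>Basis. \<Sum>j\<in>Basis. (H i j)\<^sup>2) + \<gamma> * D P)
        + (m\<^sup>2 - m - 2 * \<gamma> * m) * (s x * P x) + m * s x * a x"
    unfolding lap_w lap_a lap_P lap_s D_s E by (simp add: algebra_simps power2_eq_square)
  moreover have "w x - \<gamma> * P x - s x = a x"
    by (simp add: w_def)
  ultimately show "source (real DIM('a)) \<gamma> \<beta> m (w x) (P x) (s x) \<le>
      laplacian w x + 2 * (1 + \<gamma>) * ((gradient u x /\<^sub>R u x) \<bullet> gradient w x)"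
    unfolding source_def D_w by simp
qed

theorem theorem1p3:
  fixes q \<alpha> \<beta> n :: real
  defines "n \<equiv> real CARD('n::finite)"
  assumes dim: "CARD('n) \<ge> 3"
    and q: "q > 1"
    and \<alpha>: "\<alpha> \<ge> 0"
    and \<beta>: "\<beta> > 0"
    and \<alpha>_ge4: "CARD('n) \<ge> 4 \<Longrightarrow>
      \<alpha> < (- (n^2 + 4 * n - 4) + sqrt ((n^2 + 4 * n - 4)^2 + 64 * n)) / 16"
    and \<alpha>_eq3: "CARD('n) = 3 \<Longrightarrow> \<alpha> < (- 7 + 2 * sqrt 13) / 4"
    and \<beta>_le: "\<beta> \<le> sqrt (2 / (q - 1 - 4 * \<alpha> / n))"
    and q_ge: "q \<ge> max (8 * \<alpha> / n + 3)
      (3 * \<alpha> + sqrt (9 * \<alpha>^2 + (1 - 2 * \<alpha>) * (1 + 16 * \<alpha> / n)))"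
  shows "\<forall>\<theta>\<in>{0<..<1::real}. \<exists>C>0. \<forall>(x0 :: real^'n) R (u :: real^'n \<Rightarrow> real).
    R > 0 \<longrightarrow>
    Ck_on 4 u (ball x0 R) \<longrightarrow>
    (\<forall>x\<in>ball x0 R. u x > 0) \<longrightarrow>
    (\<forall>x\<in>ball x0 R. - bilaplacian u x = u x powr (- q)) \<longrightarrow>
    (\<forall>x\<in>ball x0 (\<theta> * R).
       - laplacian u x / u x + \<alpha> * (norm (gradient u x))^2 / (u x)^2
         + \<beta> * u x powr (- ((q + 1) / 2)) \<le> C / R^2)"
proof -
  have n3: "n \<ge> 3"
    using dim by (simp add: n_def)
  have \<alpha>_small: "\<alpha> * (n + 3) < 2"
  proof (cases "CARD('n) = 3")
    case True
    have "sqrt 13 < 4"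
      by (rule real_less_lsqrt) simp_all
    then have "\<alpha> < 1 / 4"
      using \<alpha>_eq3[OF True] by simp
    then show ?thesis
      using True by (simp add: n_def)
  next
    case False
    then show ?thesis
      using dim \<alpha>_ge4 \<alpha> by (intro alpha_mult_dim_bound) (auto simp: n_def)
  qed
  define m where "m = (q + 1) / 2"
  obtain \<gamma> c where \<gamma>: "\<gamma> \<ge> \<alpha>" "\<gamma> > 0" and c: "c > 0"
    and coercive: "\<And>w P s. w \<ge> 0 \<Longrightarrow> P \<ge> 0 \<Longrightarrow> s \<ge> 0 \<Longrightarrow>
      c * (w\<^sup>2 + P\<^sup>2) \<le> source n \<gamma> \<beta> m w P s"
    using source_coercive[OF n3 \<alpha> \<alpha>_small \<beta> \<beta>_le] q_ge unfolding m_def by auto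
  define L where "L = sqrt (2 * (4 * (n + 6))\<^sup>2 / c\<^sup>2 + (4 * (2 * (1 + \<gamma>)))^4 / (2 * c^4))"
  have L: "L > 0"
    unfolding L_def using c \<gamma> n3 by (intro real_sqrt_gt_zero add_pos_pos) auto
  show ?thesis
  proof
    fix \<theta> :: real
    assume \<theta>: "\<theta> \<in> {0<..<1}"
    \<comment> \<open>With \<open>\<rho> = (1 + \<theta>) R/2\<close>, the function \<open>\<rho>\<^sup>2 - |x - x\<^sub>0|\<^sup>2\<close> is at least \<open>\<kappa> R\<^sup>2\<close> on the ball of radius \<open>\<theta> R\<close>.\<close>
    define \<kappa> where "\<kappa> = ((1 + \<theta>) / 2)\<^sup>2 - \<theta>\<^sup>2"
    have \<kappa>: "\<kappa> > 0"
      unfolding \<kappa>_def using \<theta> power_strict_mono[of \<theta> "(1 + \<theta>) / 2" 2] by simp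
    show "\<exists>C>0. \<forall>(x0 :: real^'n) R (u :: real^'n \<Rightarrow> real).
      R > 0 \<longrightarrow>
      Ck_on 4 u (ball x0 R) \<longrightarrow>
      (\<forall>x\<in>ball x0 R. u x > 0) \<longrightarrow>
      (\<forall>x\<in>ball x0 R. - bilaplacian u x = u x powr (- q)) \<longrightarrow>
      (\<forall>x\<in>ball x0 (\<theta> * R).
         - laplacian u x / u x + \<alpha> * (norm (gradient u x))^2 / (u x)^2
           + \<beta> * u x powr (- ((q + 1) / 2)) \<le> C / R^2)"
    proof (intro exI conjI allI impI ballI)
      show "L / \<kappa>\<^sup>2 > 0"
        using L \<kappa> by simp
    next
      fix x0 :: "real^'n" and R :: real and u :: "real^'n \<Rightarrow> real" and x
      assume R: "R > 0" and u: "Ck_on 4 u (ball x0 R)"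
        and pos: "\<forall>x\<in>ball x0 R. u x > 0"
        and eq: "\<forall>x\<in>ball x0 R. - bilaplacian u x = u x powr (- q)"
        and x: "x \<in> ball x0 (\<theta> * R)"
      define P where "P y = (\<Sum>b\<in>Basis. (partial_deriv b u y / u y)\<^sup>2)" for y
      define s where "s y = \<beta> * u y powr (- m)" for y
      define w where "w y = - laplacian u y / u y + \<gamma> * P y + s y" for y
      define V where "V y = gradient u y /\<^sub>R u y" for y
      have P: "P y = (norm (gradient u y))\<^sup>2 / (u y)\<^sup>2" for y
        unfolding P_def power2_norm_eq_inner
        by (subst euclidean_inner) (simp add: inner_gradient sum_divide_distrib power2_eq_square)
      have "(norm (V y))\<^sup>2 = P y" for y
        unfolding P V_def by (simp add: power_mult_distrib divide_inverse power_inverse)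
      then have NV: "norm (V y) ^ 4 = (P y)\<^sup>2" for y
        by (metis power2_eq_square power4_eq_xxxx mult.assoc)
      have powr_eq: "1 - 2 * m = - q"
        by (simp add: m_def field_simps)
      have aux: "Ck_on 2 w (ball x0 R)"
        "source n \<gamma> \<beta> m (w y) (P y) (s y)
          \<le> laplacian w y + 2 * (1 + \<gamma>) * (V y \<bullet> gradient w y)" if "y \<in> ball x0 R" for y
        using auxiliary_function_inequality[OF open_ball that u, of m \<beta> \<gamma>] pos eq that \<beta> \<gamma>
        by (simp_all add: w_def[abs_def] P_def s_def V_def n_def powr_eq)
      \<comment> \<open>An intermediate radius, since \<open>w\<close> need not be bounded near the boundary of \<open>B\<^sub>R\<close>.\<close>
      define \<rho> where "\<rho> = (1 + \<theta>) / 2 * R"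
      have \<rho>: "0 < \<rho>" "\<rho> < R" "\<theta> * R < \<rho>"
        using \<theta> R by (auto simp: \<rho>_def)
      have sub: "cball x0 \<rho> \<subseteq> ball x0 R" "ball x0 \<rho> \<subseteq> ball x0 R"
        using \<rho> by auto
      have xr: "x \<in> ball x0 \<rho>"
        using x \<rho> by simp
      have wC: "Ck_on 2 w (ball x0 R)"
        using aux(1)[of x] xr sub by auto
      have "w x * (\<rho>\<^sup>2 - (norm (x - x0))\<^sup>2)\<^sup>2
        \<le> sqrt (2 * (4 * (real DIM(real^'n) + 6))\<^sup>2 / c\<^sup>2 + (4 * (2 * (1 + \<gamma>)))^4 / (2 * c^4)) * \<rho>\<^sup>2"
      proof (rule interior_estimate[OF \<rho>(1) c, where V = V])
        show "continuous_on (cball x0 \<rho>) w" "Ck_on 2 w (ball x0 \<rho>)"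
          using Ck_on_imp_continuous_on[OF wC] wC sub
          by (auto intro: continuous_on_subset Ck_on_subset)
        fix y assume y: "y \<in> ball x0 \<rho>" "w y \<ge> 0"
        have "P y \<ge> 0" "s y \<ge> 0"
          using \<beta> by (simp_all add: P_def s_def sum_nonneg)
        then show "c * ((w y)\<^sup>2 + norm (V y) ^ 4) \<le> laplacian w y + 2 * (1 + \<gamma>) * (V y \<bullet> gradient w y)"
          using coercive[OF y(2)] aux(2)[of y] y(1) sub by (force simp: NV)
      qed (use \<gamma> xr in auto)
      then have est: "w x * (\<rho>\<^sup>2 - (norm (x - x0))\<^sup>2)\<^sup>2 \<le> L * \<rho>\<^sup>2"
        by (simp add: L_def n_def)
      have "w x \<le> (L / \<kappa>\<^sup>2) / R\<^sup>2"
      proof (cases "w x \<ge> 0")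
        case True
        have "(norm (x - x0))\<^sup>2 \<le> (\<theta> * R)\<^sup>2"
          using x by (intro power_mono) (auto simp: dist_norm norm_minus_commute)
        then have "\<kappa> * R\<^sup>2 \<le> \<rho>\<^sup>2 - (norm (x - x0))\<^sup>2"
          unfolding \<kappa>_def \<rho>_def power_mult_distrib by (simp add: left_diff_distrib)
        then have "w x * (\<kappa> * R\<^sup>2)\<^sup>2 \<le> w x * (\<rho>\<^sup>2 - (norm (x - x0))\<^sup>2)\<^sup>2"
          using True \<kappa> by (intro mult_left_mono power_mono) auto
        also note est
        also have "L * \<rho>\<^sup>2 \<le> L * R\<^sup>2"
          using L \<rho> by (intro mult_left_mono power_mono) auto
        finally show ?thesis
          using \<kappa> R by (simp add: field_simps power2_eq_square)
      next
        case False
        then show ?thesis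
          using L by (meson divide_nonneg_nonneg le_cases less_imp_le order_trans zero_le_power2)
      qed
      moreover have "\<alpha> * P x \<le> \<gamma> * P x"
        using \<gamma> by (intro mult_right_mono) (simp_all add: P)
      ultimately show "- laplacian u x / u x + \<alpha> * (norm (gradient u x))\<^sup>2 / (u x)\<^sup>2
          + \<beta> * u x powr (- ((q + 1) / 2)) \<le> (L / \<kappa>\<^sup>2) / R\<^sup>2"
        by (simp add: w_def s_def P m_def)
    qed
  qed
qed

end
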